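(* Let $G=(V,E)$ be a locally finite graph. Assume that its (positive) edge weights satisfy $w_{xy}=w_{yx}$ for all $y\sim x\in V$, and that its measure satisfies $\mu(x)\ge\mu_{\min}>0$ for all $x\in V$, where $\mu_{\min}$ is a constant. Let $h:V\to\mathbb{R}$ be a function such that (i) there exists a constant $h_0>0$ with $h(x)\ge h_0$ for all $x\in V$; (ii) $h(x)\to+\infty$ as $\mathrm{dist}(x,x_0)\to+\infty$ for some fixed $x_0\in V$. Suppose that $f:V\times\mathbb{R}\to\mathbb{R}$ satisfies, with $F(x,s)=\int_0^s f(x,t)\,dt$: (a) for any $s,t\in\mathbb{R}$, there exists some constant $L>0$ such that $|f(x,s)-f(x,t)|\le L|s-t|$ for all $x\in V$; (b) there exists a constant $\theta>2$ such that $0<\theta F(x,s)\le s f(x,s)$ for all $x\in V$ and $s>0$; (c) for all $x\in V$, $\limsup_{s\to0+}\frac{2F(x,s)}{s^2}<\lambda_1$, where $\lambda_1=\inf_{\int_V u^2d\mu=1}\int_V(|\nabla u|^2+hu^2)\,d\mu$. Then the equation $-\Delta u+hu=f(x,u)$ has a strictly positive solution, i.e. there is $u:V\to\mathbb{R}$ with $u(x)>0$ and $-\Delta u(x)+h(x)u(x)=f(x,u(x))$ for all $x\in V$.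
   Context: $G=(V,E)$ is a graph with vertex set $V$ and edge set $E$; $y\sim x$ means $xy\in E$. Locally finite means each $x\in V$ has only finitely many $y$ with $xy\in E$. Each edge $xy$ carries a weight $w_{xy}>0$. $\mathrm{dist}(x,y)$ is the graph distance (minimal number of edges of a path from $x$ to $y$). The measure is a function $\mu:V\to(0,\infty)$, and $\int_V g\,d\mu=\sum_{x\in V}\mu(x)g(x)$. The Laplacian is $\Delta u(x)=\frac{1}{\mu(x)}\sum_{y\sim x}w_{xy}(u(y)-u(x))$, and $|\nabla u|(x)=\left(\frac{1}{2\mu(x)}\sum_{y\sim x}w_{xy}(u(y)-u(x))^2\right)^{1/2}$. $C_c(V)$ is the set of functions on $V$ with compact (finite) support; $W^{1,2}(V)$ is the completion of $C_c(V)$ under $\|u\|_{W^{1,2}(V)}=\left(\int_V(|\nabla u|^2+u^2)d\mu\right)^{1/2}$. $\mathscr{H}=\{u\in W^{1,2}(V):\int_V hu^2d\mu<+\infty\}$; the infimum defining $\lambda_1$ is over $u\in\mathscr{H}$ with $\int_Vu^2d\mu=1$.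
   Formalization: Condition (a) is taken as: for all s,t some L is a Lipschitz constant of f(x,·) on the whole interval between s and t, for all x (at the two points only, the claim fails for discontinuous f); vertices in different components have distance ∞, so (ii) makes G connected. *)

theory Defs
  imports "HOL-Analysis.Analysis"
begin

text \<open>
  The vertex set is the type \<open>'v\<close>. The edge set is a relation \<open>E\<close> on \<open>'v\<close>, with \<open>(x, y) \<in> E\<close>
  meaning \<open>x \<sim> y\<close>; undirectedness is the assumption \<open>sym E\<close>. Loops are not excluded: they
  contribute nothing to any of the quantities below. The weights are a function \<open>w\<close> of two
  vertices whose values matter on edges only.
\<close>

definition locally_finite :: "'v rel \<Rightarrow> bool" where
  "locally_finite E \<longleftrightarrow> (\<forall>x. finite {y. (x, y) \<in> E})"

text \<open>
  \<open>(x, y) \<in> E ^^ n\<close> says that some path with \<open>n\<close> edges leads from \<open>x\<close> to \<open>y\<close>. The infimum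
  over the empty set is \<open>\<infinity>\<close>, the distance of vertices in different components.
\<close>

definition graph_dist :: "'v rel \<Rightarrow> 'v \<Rightarrow> 'v \<Rightarrow> enat" where
  "graph_dist E x y = (INF n\<in>{n. (x, y) \<in> E ^^ n}. enat n)"

text \<open>
  Vertices at distance \<open>\<infinity>\<close> from \<open>x\<^sub>0\<close> are subject to the bound for every \<open>M\<close>, so this
  condition can only hold if every vertex is connected to \<open>x\<^sub>0\<close>.
\<close>

definition tends_to_infinity :: "'v rel \<Rightarrow> 'v \<Rightarrow> ('v \<Rightarrow> real) \<Rightarrow> bool" where
  "tends_to_infinity E x\<^sub>0 h \<longleftrightarrow>
     (\<forall>M. \<exists>R::nat. \<forall>x. graph_dist E x x\<^sub>0 \<ge> enat R \<longrightarrow> h x \<ge> M)"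

definition laplacian ::
    "'v rel \<Rightarrow> ('v \<Rightarrow> 'v \<Rightarrow> real) \<Rightarrow> ('v \<Rightarrow> real) \<Rightarrow> ('v \<Rightarrow> real) \<Rightarrow> 'v \<Rightarrow> real" where
  "laplacian E w \<mu> u x = 1 / \<mu> x * (\<Sum>y | (x, y) \<in> E. w x y * (u y - u x))"

definition grad_norm ::
    "'v rel \<Rightarrow> ('v \<Rightarrow> 'v \<Rightarrow> real) \<Rightarrow> ('v \<Rightarrow> real) \<Rightarrow> ('v \<Rightarrow> real) \<Rightarrow> 'v \<Rightarrow> real" where
  "grad_norm E w \<mu> u x =
     sqrt (1 / (2 * \<mu> x) * (\<Sum>y | (x, y) \<in> E. w x y * (u y - u x)\<^sup>2))"

text \<open>
  The integral of a nonnegative function, with value \<open>top\<close> if the sum diverges. The coercion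
  \<open>ennreal\<close> sends negative numbers to \<open>0\<close>, so this is not meant for signed integrands.
\<close>

definition graph_integral :: "('v \<Rightarrow> real) \<Rightarrow> ('v \<Rightarrow> real) \<Rightarrow> ennreal" where
  "graph_integral \<mu> g = (\<Sum>\<^sub>\<infinity>x. ennreal (\<mu> x * g x))"

definition finitely_supported :: "('v \<Rightarrow> real) set" where
  "finitely_supported = {u. finite {x. u x \<noteq> 0}}"

text \<open>The value is \<open>top\<close> for functions whose norm is infinite.\<close>

definition W12_norm ::
    "'v rel \<Rightarrow> ('v \<Rightarrow> 'v \<Rightarrow> real) \<Rightarrow> ('v \<Rightarrow> real) \<Rightarrow> ('v \<Rightarrow> real) \<Rightarrow> ennreal" where
  "W12_norm E w \<mu> u =
     (let I = graph_integral \<mu> (\<lambda>x. (grad_norm E w \<mu> u x)\<^sup>2 + (u x)\<^sup>2)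
      in if I = top then top else ennreal (sqrt (enn2real I)))"

text \<open>
  As \<open>\<mu>\<close> is positive, convergence in the norm implies pointwise convergence, and the functions of
  finite norm form a complete space. The completion of the finitely supported functions is
  therefore realised by functions, as their closure with respect to the norm.
\<close>

definition W12 ::
    "'v rel \<Rightarrow> ('v \<Rightarrow> 'v \<Rightarrow> real) \<Rightarrow> ('v \<Rightarrow> real) \<Rightarrow> ('v \<Rightarrow> real) set" where
  "W12 E w \<mu> =
     {u. W12_norm E w \<mu> u < top \<and>
         (\<exists>\<phi> :: nat \<Rightarrow> 'v \<Rightarrow> real. (\<forall>n. \<phi> n \<in> finitely_supported) \<and>
            (\<lambda>n. W12_norm E w \<mu> (\<lambda>x. u x - \<phi> n x)) \<longlonglongrightarrow> 0)}"

definition energy_space ::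
    "'v rel \<Rightarrow> ('v \<Rightarrow> 'v \<Rightarrow> real) \<Rightarrow> ('v \<Rightarrow> real) \<Rightarrow> ('v \<Rightarrow> real) \<Rightarrow> ('v \<Rightarrow> real) set" where
  "energy_space E w \<mu> h =
     {u \<in> W12 E w \<mu>. graph_integral \<mu> (\<lambda>x. h x * (u x)\<^sup>2) < top}"

definition lambda1 ::
    "'v rel \<Rightarrow> ('v \<Rightarrow> 'v \<Rightarrow> real) \<Rightarrow> ('v \<Rightarrow> real) \<Rightarrow> ('v \<Rightarrow> real) \<Rightarrow> ennreal" where
  "lambda1 E w \<mu> h =
     (INF u\<in>{u \<in> energy_space E w \<mu> h. graph_integral \<mu> (\<lambda>x. (u x)\<^sup>2) = 1}.
        graph_integral \<mu> (\<lambda>x. (grad_norm E w \<mu> u x)\<^sup>2 + h x * (u x)\<^sup>2))"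

definition primitive :: "('v \<Rightarrow> real \<Rightarrow> real) \<Rightarrow> 'v \<Rightarrow> real \<Rightarrow> real" where
  "primitive f x s = (LBINT t=ereal 0..ereal s. f x t)"

text \<open>
  For all \<open>s\<close>, \<open>t\<close> there is a Lipschitz constant that is valid between \<open>s\<close> and \<open>t\<close> and does not
  depend on the vertex. A single constant for all \<open>s\<close> and \<open>t\<close> would force linear growth and
  exclude superquadratic primitives; requiring the inequality at the two points \<open>s\<close>, \<open>t\<close> only
  would not even make \<open>f x\<close> continuous.
\<close>

definition locally_lipschitz_uniformly :: "('v \<Rightarrow> real \<Rightarrow> real) \<Rightarrow> bool" where
  "locally_lipschitz_uniformly f \<longleftrightarrow>
     (\<forall>s t. \<exists>L>0. \<forall>x. \<forall>a\<in>closed_segment s t. \<forall>b\<in>closed_segment s t.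
        \<bar>f x a - f x b\<bar> \<le> L * \<bar>a - b\<bar>)"

end

theory Submission
  imports Defs "HOL-Complex_Analysis.Great_Picard"
begin

text \<open>
  Functions supported in a ball \<open>B n\<close> around \<open>x\<^sub>0\<close> form a finite-dimensional space, on which the
  energy functional \<open>J\<close> has mountain pass geometry with constants independent of \<open>n\<close>. Explicit
  gradient descent replaces the mountain pass theorem: a descent map with small steps fixes \<open>0\<close>,
  decreases \<open>J\<close> and preserves nonnegativity, so its iterates move the segment from \<open>0\<close> to a point with
  \<open>J < 0\<close> through curves that all cross the mountain rim. By compactness the orbit of one point of
  the segment stays above the rim level \<open>\<alpha>\<close> forever. The Ambrosetti-Rabinowitz condition bounds this
  orbit, so the gradient becomes arbitrarily small along it. Taking \<open>u n\<close> on \<open>B n\<close> with gradient at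
  most \<open>1 / (n + 1)\<close>, the energies are bounded, a subsequence converges pointwise, and the limit solves
  the equation because the latter is local. Since \<open>h\<close> is large off a finite set, a fixed amount of
  mass stays on that set, so the limit is not zero; a nonnegative solution vanishing at one vertex
  vanishes at its neighbours, hence everywhere on the connected graph.
\<close>

section \<open>The quadratic form on finitely supported functions\<close>

definition supported_on :: "'v set \<Rightarrow> ('v \<Rightarrow> real) \<Rightarrow> bool" where
  "supported_on K u \<longleftrightarrow> (\<forall>x. x \<notin> K \<longrightarrow> u x = 0)"

lemma infsum_ennreal_supported_on:
  assumes "finite K" and "supported_on K g" and "\<And>x. 0 \<le> g x"
  shows "(\<Sum>\<^sub>\<infinity>x. ennreal (g x)) = ennreal (\<Sum>x\<in>K. g x)"
proof -
  have "(\<Sum>\<^sub>\<infinity>x. ennreal (g x)) = (\<Sum>\<^sub>\<infinity>x\<in>K. ennreal (g x))"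
    using assms(2) by (intro infsum_cong_neutral) (auto simp: supported_on_def)
  also have "\<dots> = ennreal (\<Sum>x\<in>K. g x)"
    using assms by simp
  finally show ?thesis .
qed

text \<open>The single constant \<open>m\<close> bounds \<open>\<mu> x * h x\<close> from below,
  since this product is the coefficient of \<open>u x\<close> squared once sums are taken with
  respect to the counting measure.\<close>

locale schroedinger_graph =
  fixes E :: "'v rel"
    and w :: "'v \<Rightarrow> 'v \<Rightarrow> real"
    and \<mu> h :: "'v \<Rightarrow> real"
    and m :: real
  assumes sym_edges: "sym E"
    and locally_finite: "locally_finite E"
    and weight_pos: "(x, y) \<in> E \<Longrightarrow> w x y > 0"
    and weight_sym: "(x, y) \<in> E \<Longrightarrow> w x y = w y x"
    and measure_pos: "\<mu> x > 0"
    and m_pos: "m > 0"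
    and m_le: "m \<le> \<mu> x * h x"
begin

text \<open>Extending the weights by zero turns neighbour sums into sums over one fixed finite set,
  so that double sums can be swapped.\<close>

definition W :: "'v \<Rightarrow> 'v \<Rightarrow> real" where
  "W x y = (if (x, y) \<in> E then w x y else 0)"

definition wdeg :: "'v \<Rightarrow> real" where
  "wdeg x = (\<Sum>y | (x, y) \<in> E. w x y)"

text \<open>The operator \<open>\<mu> (- \<Delta> + h)\<close>, which is symmetric with respect to the counting measure.\<close>

definition S :: "('v \<Rightarrow> real) \<Rightarrow> 'v \<Rightarrow> real" where
  "S u x = (\<Sum>y | (x, y) \<in> E. w x y * (u x - u y)) + \<mu> x * h x * u x"

text \<open>Equals the integral of \<open>|\<nabla>u|\<^sup>2 + h u\<^sup>2\<close> when \<open>u\<close> is supported on \<open>K\<close>; in general it omits the part of the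
  gradient outside \<open>K\<close>.\<close>

definition energy :: "'v set \<Rightarrow> ('v \<Rightarrow> real) \<Rightarrow> real" where
  "energy K u = (\<Sum>x\<in>K. u x * S u x)"

section \<open>Algebra of the operator and its quadratic form\<close>

lemma finite_neighbours [simp]: "finite {y. (x, y) \<in> E}"
  using locally_finite by (auto simp: locally_finite_def)

lemma W_sym: "W x y = W y x"
  using weight_sym sym_edges by (auto simp: W_def dest: symD)

lemma W_nonneg: "0 \<le> W x y"
  using weight_pos by (auto simp: W_def intro: less_imp_le)

lemma wdeg_nonneg: "0 \<le> wdeg x"
  unfolding wdeg_def using weight_pos by (intro sum_nonneg) (auto intro: less_imp_le)

lemma potential_pos: "0 < \<mu> x * h x"
  using m_pos m_le by (rule less_le_trans)

lemma h_pos: "0 < h x"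
  using potential_pos measure_pos zero_less_mult_pos by blast

lemma sum_neighbours:
  assumes "finite K" and "\<And>y. (x, y) \<in> E \<Longrightarrow> y \<notin> K \<Longrightarrow> g y = 0"
  shows "(\<Sum>y | (x, y) \<in> E. w x y * g y) = (\<Sum>y\<in>K. W x y * g y)"
proof -
  have "(\<Sum>y | (x, y) \<in> E. w x y * g y) = (\<Sum>y\<in>{y. (x, y) \<in> E} \<union> K. W x y * g y)"
    using assms(1) by (intro sum.mono_neutral_cong_left) (auto simp: W_def)
  also have "\<dots> = (\<Sum>y\<in>K. W x y * g y)"
    using assms by (intro sum.mono_neutral_right) (auto simp: W_def)
  finally show ?thesis .
qed

lemma S_eq_laplacian: "S u x = \<mu> x * (- laplacian E w \<mu> u x + h x * u x)"
proof -
  have "(\<Sum>y | (x, y) \<in> E. w x y * (u x - u y)) = - (\<Sum>y | (x, y) \<in> E. w x y * (u y - u x))"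
    by (simp add: sum_negf[symmetric] algebra_simps)
  then show ?thesis
    using measure_pos[of x] by (simp add: S_def laplacian_def field_simps)
qed

text \<open>This form separates the diagonal of the operator from the off-diagonal part, whose
  entries are nonpositive. That sign keeps the descent among nonnegative functions and spreads zeros
  of a solution.\<close>

lemma S_eq_wdeg:
  "S u x = (wdeg x + \<mu> x * h x) * u x - (\<Sum>y | (x, y) \<in> E. w x y * u y)"
  by (simp add: S_def wdeg_def right_diff_distrib sum_subtractf sum_distrib_right sum_distrib_left algebra_simps)

lemma S_supported_on:
  assumes "finite K" and "supported_on K u"
  shows "S u x = (wdeg x + \<mu> x * h x) * u x - (\<Sum>y\<in>K. W x y * u y)"
  using assms by (subst S_eq_wdeg, subst sum_neighbours[of K]) (auto simp: supported_on_def)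

lemma S_add: "S (\<lambda>x. u x + v x) x = S u x + S v x"
  by (simp add: S_eq_wdeg algebra_simps sum.distrib)

lemma S_scale: "S (\<lambda>x. c * u x) x = c * S u x"
  by (simp add: S_eq_wdeg algebra_simps sum_distrib_left)

lemma energy_scale: "energy K (\<lambda>x. c * u x) = c\<^sup>2 * energy K u"
  by (simp add: energy_def S_scale sum_distrib_left power2_eq_square algebra_simps)

lemma S_symmetric:
  assumes "finite K" and "supported_on K u" and "supported_on K v"
  shows "(\<Sum>x\<in>K. v x * S u x) = (\<Sum>x\<in>K. u x * S v x)"
proof -
  have "(\<Sum>x\<in>K. \<Sum>y\<in>K. W x y * v x * u y) = (\<Sum>x\<in>K. \<Sum>y\<in>K. W x y * u x * v y)"
    by (subst sum.swap) (simp add: W_sym mult_ac)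
  then show ?thesis
    by (simp add: S_supported_on[OF assms(1,2)] S_supported_on[OF assms(1,3)] right_diff_distrib
        sum_subtractf sum_distrib_left mult_ac)
qed

lemma energy_add:
  assumes "finite K" and "supported_on K u" and "supported_on K d"
  shows "energy K (\<lambda>x. u x + d x) = energy K u + 2 * (\<Sum>x\<in>K. d x * S u x) + energy K d"
  using S_symmetric[OF assms] by (simp add: energy_def S_add algebra_simps sum.distrib)

text \<open>Summation by parts. The double sum meets every edge from both ends, which the factor 1/2
  in \<open>grad_norm\<close> compensates.\<close>

lemma energy_eq_Dirichlet:
  assumes "finite K" and "supported_on K u"
  obtains K' where "finite K'" and "K \<subseteq> K'"
    and "supported_on K' (grad_norm E w \<mu> u)"
    and "energy K u = (\<Sum>x\<in>K'. \<mu> x * ((grad_norm E w \<mu> u x)\<^sup>2 + h x * (u x)\<^sup>2))"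
proof
  \<comment> \<open>The gradient of a function supported on \<open>K\<close> may be nonzero on
    neighbours of \<open>K\<close>, but no further out.\<close>
  define K' where "K' = K \<union> (\<Union>x\<in>K. {y. (x, y) \<in> E})"
  show fin: "finite K'" and sub: "K \<subseteq> K'"
    using assms(1) by (auto simp: K'_def)
  have u0: "u x = 0" if "x \<notin> K" for x
    using assms(2) that by (simp add: supported_on_def)
  have nb: "y \<in> K'" if "(x, y) \<in> E" "x \<in> K \<or> y \<in> K" "x \<in> K'" for x y
    using that by (auto simp: K'_def)
  have nb': "y \<notin> K" if "(x, y) \<in> E" "x \<notin> K'" for x y
    using that sym_edges by (auto simp: K'_def dest: symD)
  have grad: "\<mu> x * (grad_norm E w \<mu> u x)\<^sup>2 = 1/2 * (\<Sum>y | (x, y) \<in> E. w x y * (u y - u x)\<^sup>2)" for x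
  proof -
    have "0 \<le> (\<Sum>y | (x, y) \<in> E. w x y * (u y - u x)\<^sup>2)"
      using weight_pos by (intro sum_nonneg mult_nonneg_nonneg) (auto intro: less_imp_le)
    then show ?thesis
      using measure_pos[of x] by (simp add: grad_norm_def)
  qed
  show "supported_on K' (grad_norm E w \<mu> u)"
    unfolding supported_on_def
  proof (intro allI impI)
    fix x assume x: "x \<notin> K'"
    have "u y - u x = 0" if "(x, y) \<in> E" for y
      using x nb'[OF that x] u0[of x] u0[of y] sub by auto
    then show "grad_norm E w \<mu> u x = 0"
      by (simp add: grad_norm_def)
  qed
  have grad': "(\<Sum>y | (x, y) \<in> E. w x y * (u y - u x)\<^sup>2) = (\<Sum>y\<in>K'. W x y * (u y - u x)\<^sup>2)"
    if "x \<in> K'" for x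
  proof (rule sum_neighbours[OF fin])
    fix y assume "(x, y) \<in> E" "y \<notin> K'"
    then show "(u y - u x)\<^sup>2 = 0"
      using nb[OF _ _ that, of y] u0[of x] u0[of y] sub by force
  qed
  have swap: "(\<Sum>x\<in>K'. \<Sum>y\<in>K'. W x y * (u y)\<^sup>2) = (\<Sum>x\<in>K'. \<Sum>y\<in>K'. W x y * (u x)\<^sup>2)"
    by (subst sum.swap) (simp add: W_sym)
  have Su: "S u x = (\<Sum>y\<in>K'. W x y * (u x - u y)) + \<mu> x * h x * u x" if "x \<in> K'" "u x \<noteq> 0" for x
  proof -
    have "x \<in> K" using that u0 by blast
    then show ?thesis
      unfolding S_def using nb that
      by (subst sum_neighbours[OF fin]) auto
  qed
  have "energy K u = (\<Sum>x\<in>K'. u x * S u x)"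
    unfolding energy_def using fin sub u0 by (intro sum.mono_neutral_left) auto
  also have "\<dots> = (\<Sum>x\<in>K'. u x * ((\<Sum>y\<in>K'. W x y * (u x - u y)) + \<mu> x * h x * u x))"
    using Su by (intro sum.cong) auto
  also have "\<dots> = (\<Sum>x\<in>K'. \<Sum>y\<in>K'. W x y * (u x)\<^sup>2) - (\<Sum>x\<in>K'. \<Sum>y\<in>K'. W x y * u x * u y)
      + (\<Sum>x\<in>K'. \<mu> x * h x * (u x)\<^sup>2)"
    by (simp add: sum.distrib sum_subtractf sum_distrib_left algebra_simps power2_eq_square)
  also have "\<dots> = (\<Sum>x\<in>K'. 1/2 * (\<Sum>y\<in>K'. W x y * (u y - u x)\<^sup>2)) + (\<Sum>x\<in>K'. \<mu> x * h x * (u x)\<^sup>2)"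
  proof -
    have "(\<Sum>x\<in>K'. \<Sum>y\<in>K'. W x y * (u y - u x)\<^sup>2) = (\<Sum>x\<in>K'. \<Sum>y\<in>K'. W x y * (u y)\<^sup>2)
        + (\<Sum>x\<in>K'. \<Sum>y\<in>K'. W x y * (u x)\<^sup>2) - 2 * (\<Sum>x\<in>K'. \<Sum>y\<in>K'. W x y * u x * u y)"
      unfolding sum_distrib_left[of 2] sum.distrib[symmetric] sum_subtractf[symmetric]
      by (intro sum.cong) (auto simp: power2_diff algebra_simps)
    then show ?thesis
      using swap by (simp add: sum_divide_distrib[symmetric])
  qed
  also have "\<dots> = (\<Sum>x\<in>K'. \<mu> x * (grad_norm E w \<mu> u x)\<^sup>2) + (\<Sum>x\<in>K'. \<mu> x * h x * (u x)\<^sup>2)"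
    by (simp only: grad grad' cong: sum.cong)
  finally show "energy K u = (\<Sum>x\<in>K'. \<mu> x * ((grad_norm E w \<mu> u x)\<^sup>2 + h x * (u x)\<^sup>2))"
    by (simp add: algebra_simps sum.distrib)
qed

lemma energy_ge_potential:
  assumes "finite K" and "supported_on K u"
  shows "(\<Sum>x\<in>K. \<mu> x * h x * (u x)\<^sup>2) \<le> energy K u"
proof -
  obtain K' where K': "finite K'" "K \<subseteq> K'"
    "energy K u = (\<Sum>x\<in>K'. \<mu> x * ((grad_norm E w \<mu> u x)\<^sup>2 + h x * (u x)\<^sup>2))"
    using energy_eq_Dirichlet[OF assms] .
  have "(\<Sum>x\<in>K. \<mu> x * h x * (u x)\<^sup>2) \<le> (\<Sum>x\<in>K'. \<mu> x * h x * (u x)\<^sup>2)"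
    using K' by (intro sum_mono2 mult_nonneg_nonneg[OF less_imp_le[OF potential_pos]]) auto
  also have "\<dots> \<le> energy K u"
    unfolding K'(3)
    by (intro sum_mono) (simp add: algebra_simps less_imp_le[OF measure_pos])
  finally show ?thesis .
qed

lemma energy_ge_L2_set:
  assumes "finite K" and "supported_on K u"
  shows "m * (L2_set u K)\<^sup>2 \<le> energy K u"
proof -
  have "m * (L2_set u K)\<^sup>2 = (\<Sum>x\<in>K. m * (u x)\<^sup>2)"
    by (simp add: L2_set_def sum_nonneg sum_distrib_left)
  also have "\<dots> \<le> (\<Sum>x\<in>K. \<mu> x * h x * (u x)\<^sup>2)"
    using m_le by (intro sum_mono mult_right_mono) auto
  finally show ?thesis
    using energy_ge_potential[OF assms] by linarith
qed

lemma energy_ge_square: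
  assumes "finite K" and "supported_on K u"
  shows "m * (u x)\<^sup>2 \<le> energy K u"
proof (cases "x \<in> K")
  case True
  have "(u x)\<^sup>2 \<le> (L2_set u K)\<^sup>2"
    using member_le_L2_set[OF assms(1) True, of "\<lambda>x. \<bar>u x\<bar>"]
    by (simp add: L2_set_def abs_le_square_iff[symmetric])
  then show ?thesis
    using energy_ge_L2_set[OF assms] m_pos by (meson less_imp_le mult_left_mono order_trans)
next
  case False
  then show ?thesis
    using assms(2) energy_ge_L2_set[OF assms] m_pos
    by (auto simp: supported_on_def intro: order_trans[rotated])
qed

section \<open>Upper bounds for the operator and comparison with the eigenvalue\<close>

lemma abs_S_le:
  assumes "\<And>y. \<bar>u y\<bar> \<le> B"
  shows "\<bar>S u x\<bar> \<le> (2 * wdeg x + \<mu> x * h x) * B"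
proof -
  have B: "0 \<le> B" using assms[of x] by linarith
  have "\<bar>\<Sum>y | (x, y) \<in> E. w x y * (u x - u y)\<bar> \<le> (\<Sum>y | (x, y) \<in> E. w x y * (2 * B))"
  proof (rule order_trans[OF sum_abs], rule sum_mono)
    fix y assume "y \<in> {y. (x, y) \<in> E}"
    then have "0 < w x y" using weight_pos by simp
    moreover have "\<bar>u x - u y\<bar> \<le> 2 * B" using assms[of x] assms[of y] by linarith
    ultimately show "\<bar>w x y * (u x - u y)\<bar> \<le> w x y * (2 * B)"
      by (simp add: abs_mult)
  qed
  also have "\<dots> = 2 * wdeg x * B"
    by (simp add: wdeg_def sum_distrib_right sum_distrib_left mult_ac)
  finally have "\<bar>\<Sum>y | (x, y) \<in> E. w x y * (u x - u y)\<bar> \<le> 2 * wdeg x * B" .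
  moreover have "\<bar>\<mu> x * h x * u x\<bar> \<le> \<mu> x * h x * B"
    unfolding abs_mult[of "\<mu> x * h x"] abs_of_pos[OF potential_pos]
    using potential_pos[of x] assms[of x] by (intro mult_left_mono) auto
  ultimately show ?thesis
    unfolding S_def by (simp add: algebra_simps)
qed

text \<open>A crude norm bound for the matrix of \<open>S\<close> on \<open>K\<close>, obtained by
  adding the row bounds of \<open>abs_S_le\<close>. The step size of the descent depends on
  it.\<close>

definition \<Lambda> :: "'v set \<Rightarrow> real" where
  "\<Lambda> K = (\<Sum>x\<in>K. 2 * wdeg x + \<mu> x * h x)"

lemma \<Lambda>_summand_nonneg: "0 \<le> 2 * wdeg x + \<mu> x * h x"
  using wdeg_nonneg[of x] potential_pos[of x] by linarith

lemma \<Lambda>_nonneg: "0 \<le> \<Lambda> K"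
  unfolding \<Lambda>_def using \<Lambda>_summand_nonneg by (intro sum_nonneg) auto

lemma \<Lambda>_ge: "finite K \<Longrightarrow> x \<in> K \<Longrightarrow> wdeg x + \<mu> x * h x \<le> \<Lambda> K"
  unfolding \<Lambda>_def using member_le_sum[of x K "\<lambda>x. 2 * wdeg x + \<mu> x * h x"] \<Lambda>_summand_nonneg
    wdeg_nonneg[of x] by fastforce

lemma abs_le_L2_set:
  assumes "finite K" and "supported_on K u"
  shows "\<bar>u x\<bar> \<le> L2_set u K"
proof (cases "x \<in> K")
  case True
  then show ?thesis
    using member_le_L2_set[OF assms(1) True, of "\<lambda>x. \<bar>u x\<bar>"] by (simp add: L2_set_def)
next
  case False
  then show ?thesis using assms(2) by (simp add: supported_on_def)
qed

lemma energy_le: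
  assumes "finite K" and "supported_on K u"
  shows "energy K u \<le> \<Lambda> K * (L2_set u K)\<^sup>2"
proof -
  let ?B = "L2_set u K"
  have "u x * S u x \<le> (2 * wdeg x + \<mu> x * h x) * ?B\<^sup>2" for x
  proof -
    have "u x * S u x \<le> \<bar>u x\<bar> * \<bar>S u x\<bar>"
      by (simp add: abs_mult[symmetric])
    also have "\<dots> \<le> ?B * ((2 * wdeg x + \<mu> x * h x) * ?B)"
      using abs_le_L2_set[OF assms] by (intro mult_mono abs_S_le) auto
    finally show ?thesis by (simp add: power2_eq_square mult_ac)
  qed
  then show ?thesis
    unfolding energy_def \<Lambda>_def sum_distrib_right by (intro sum_mono)
qed

text \<open>Rescaling \<open>u\<close> to unit mass makes it a competitor in the infimum, and the
  energy is homogeneous of degree two.\<close>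

lemma lambda1_le_energy:
  assumes K: "finite K" "supported_on K u"
  shows "lambda1 E w \<mu> h * ennreal (\<Sum>x\<in>K. \<mu> x * (u x)\<^sup>2) \<le> ennreal (energy K u)"
proof -
  have integral: "graph_integral \<mu> (\<lambda>x. (grad_norm E w \<mu> v x)\<^sup>2 + h x * (v x)\<^sup>2) = ennreal (energy K v)"
    if v: "supported_on K v" for v
  proof -
    obtain K' where K': "finite K'" "K \<subseteq> K'" "supported_on K' (grad_norm E w \<mu> v)"
      "energy K v = (\<Sum>x\<in>K'. \<mu> x * ((grad_norm E w \<mu> v x)\<^sup>2 + h x * (v x)\<^sup>2))"
      using energy_eq_Dirichlet[OF K(1) v] .
    show ?thesis
      unfolding graph_integral_def K'(4)
    proof (rule infsum_ennreal_supported_on[OF K'(1)])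
      show "supported_on K' (\<lambda>x. \<mu> x * ((grad_norm E w \<mu> v x)\<^sup>2 + h x * (v x)\<^sup>2))"
        using K'(2,3) v by (auto simp: supported_on_def)
      show "0 \<le> \<mu> x * ((grad_norm E w \<mu> v x)\<^sup>2 + h x * (v x)\<^sup>2)" for x
        using measure_pos[of x] h_pos[of x] by simp
    qed
  qed
  have integral_W12: "graph_integral \<mu> (\<lambda>x. (grad_norm E w \<mu> v x)\<^sup>2 + (v x)\<^sup>2) < top"
    if v: "supported_on K v" for v
  proof -
    obtain K' where K': "finite K'" "K \<subseteq> K'" "supported_on K' (grad_norm E w \<mu> v)"
      using energy_eq_Dirichlet[OF K(1) v] by metis
    show ?thesis
      unfolding graph_integral_def
    proof (subst infsum_ennreal_supported_on[OF K'(1)])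
      show "supported_on K' (\<lambda>x. \<mu> x * ((grad_norm E w \<mu> v x)\<^sup>2 + (v x)\<^sup>2))"
        using K'(2,3) v by (auto simp: supported_on_def)
      show "0 \<le> \<mu> x * ((grad_norm E w \<mu> v x)\<^sup>2 + (v x)\<^sup>2)" for x
        using measure_pos[of x] by simp
    qed simp
  qed
  have integral_sq: "graph_integral \<mu> (\<lambda>x. g x * (v x)\<^sup>2) = ennreal (\<Sum>x\<in>K. \<mu> x * (g x * (v x)\<^sup>2))"
    if v: "supported_on K v" and g: "\<And>x. 0 \<le> g x" for v g
    unfolding graph_integral_def using v measure_pos g
    by (intro infsum_ennreal_supported_on[OF K(1)])
      (auto simp: supported_on_def intro!: mult_nonneg_nonneg less_imp_le[OF measure_pos])
  have space: "v \<in> energy_space E w \<mu> h" if v: "supported_on K v" for v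
  proof -
    have fin: "v \<in> finitely_supported"
      using v K(1) by (auto simp: finitely_supported_def supported_on_def intro: finite_subset)
    have zero: "W12_norm E w \<mu> (\<lambda>x. v x - v x) = 0"
      by (simp add: W12_norm_def graph_integral_def grad_norm_def)
    have "W12_norm E w \<mu> v < top"
      using integral_W12[OF v] by (auto simp: W12_norm_def Let_def)
    moreover have "\<exists>\<phi>. (\<forall>n. \<phi> n \<in> finitely_supported) \<and>
        (\<lambda>n::nat. W12_norm E w \<mu> (\<lambda>x. v x - \<phi> n x)) \<longlonglongrightarrow> 0"
      \<comment> \<open>The constant sequence \<open>v\<close> approximates
        \<open>v\<close>.\<close>
      using fin zero by (intro exI[of _ "\<lambda>_. v"]) simp
    ultimately have "v \<in> W12 E w \<mu>"
      by (simp add: W12_def)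
    then show ?thesis
      using integral_sq[OF v, of h] h_pos by (simp add: energy_space_def less_imp_le)
  qed
  show ?thesis
  \<comment> \<open>Zero mass cannot be normalised; there the left-hand side is 0, since in
    \<open>ennreal\<close> even \<open>top * 0\<close> is 0.\<close>
  proof (cases "(\<Sum>x\<in>K. \<mu> x * (u x)\<^sup>2) = 0")
    case False
    define s where "s = (\<Sum>x\<in>K. \<mu> x * (u x)\<^sup>2)"
    have "0 \<le> s"
      unfolding s_def by (intro sum_nonneg mult_nonneg_nonneg less_imp_le[OF measure_pos]) auto
    with False have s: "0 < s" by (simp add: s_def)
    define v where "v = (\<lambda>x. (1 / sqrt s) * u x)"
    have v: "supported_on K v"
      using K(2) by (simp add: v_def supported_on_def)
    have "(\<Sum>x\<in>K. \<mu> x * (v x)\<^sup>2) = 1"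
      using s by (simp add: v_def power_mult_distrib power_divide s_def flip: sum_divide_distrib)
    then have "graph_integral \<mu> (\<lambda>x. (v x)\<^sup>2) = 1"
      using integral_sq[OF v, of "\<lambda>_. 1"] by simp
    then have "lambda1 E w \<mu> h \<le> ennreal (energy K v)"
      unfolding lambda1_def integral[OF v, symmetric] using space[OF v] by (intro INF_lower) simp
    then have "lambda1 E w \<mu> h * ennreal s \<le> ennreal (energy K v) * ennreal s"
      by (rule mult_right_mono) simp
    also have "\<dots> = ennreal (energy K u)"
    proof -
      have "energy K v * s = energy K u"
        unfolding v_def energy_scale using s by (simp add: power_divide)
      moreover have "0 \<le> energy K v"
        using energy_ge_L2_set[OF K(1) v] m_pos by (meson less_imp_le mult_nonneg_nonneg order_trans zero_le_power2)
      ultimately show ?thesis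
        using s by (simp add: ennreal_mult[symmetric])
    qed
    finally show ?thesis by (simp add: s_def)
  qed simp
qed

end

section \<open>Orbits of a descent map\<close>

text \<open>After \<open>k\<close> steps the path still joins the fixed point, where
  \<open>Q < \<rho>\<close>, to a point with \<open>J < 0\<close>, which lies beyond the rim. The
  intermediate value theorem gives a crossing, where \<open>J\<close> is at least \<alpha>. Since
  \<open>J\<close> decreases along orbits, the parameters that are still at level \<alpha> after
  \<open>k\<close> steps form nested nonempty compact sets.\<close>

lemma orbit_stays_above:
  fixes \<Phi> :: "'a::topological_space \<Rightarrow> 'a" and J Q :: "'a \<Rightarrow> real" and \<gamma> :: "real \<Rightarrow> 'a"
  assumes cont: "continuous_on C \<Phi>" "continuous_on C J" "continuous_on C Q" "continuous_on {0..1} \<gamma>"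
    and \<Phi>_into: "\<And>u. u \<in> C \<Longrightarrow> \<Phi> u \<in> C" and \<gamma>_into: "\<And>t. t \<in> {0..1} \<Longrightarrow> \<gamma> t \<in> C"
    and descent: "\<And>u. u \<in> C \<Longrightarrow> J (\<Phi> u) \<le> J u"
    and start: "\<Phi> (\<gamma> 0) = \<gamma> 0" "Q (\<gamma> 0) < \<rho>" and finish: "J (\<gamma> 1) < 0"
    and inside: "\<And>u. u \<in> C \<Longrightarrow> Q u \<le> \<rho> \<Longrightarrow> 0 \<le> J u"
    and rim: "\<And>u. u \<in> C \<Longrightarrow> Q u = \<rho> \<Longrightarrow> \<alpha> \<le> J u"
  obtains t where "t \<in> {0..1}" and "\<And>k. \<alpha> \<le> J ((\<Phi> ^^ k) (\<gamma> t))"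
proof -
  define v where "v k t = (\<Phi> ^^ k) (\<gamma> t)" for k t
  have v_into: "v k t \<in> C" if "t \<in> {0..1}" for k t
    using that by (induction k) (auto simp: v_def \<Phi>_into \<gamma>_into)
  have v_cont: "continuous_on {0..1} (v k)" for k
  proof (induction k)
    case 0
    then show ?case using cont(4) by (simp add: v_def)
  next
    case (Suc k)
    have "continuous_on {0..1} (\<lambda>t. \<Phi> (v k t))"
      using v_into by (intro continuous_on_compose2[OF cont(1) Suc]) auto
    then show ?case by (simp add: v_def)
  qed
  have J_cont: "continuous_on {0..1} (\<lambda>t. J (v k t))" for k
    using v_into by (intro continuous_on_compose2[OF cont(2) v_cont]) auto
  have Q_cont: "continuous_on {0..1} (\<lambda>t. Q (v k t))" for k
    using v_into by (intro continuous_on_compose2[OF cont(3) v_cont]) auto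
  have J_step: "J (v (Suc k) t) \<le> J (v k t)" if "t \<in> {0..1}" for k t
    using descent[OF v_into[OF that, of k]] by (simp add: v_def)
  have J_mono: "J (v n t) \<le> J (v k t)" if "t \<in> {0..1}" "k \<le> n" for k n t
    using lift_Suc_antimono_le[of "\<lambda>k. J (v k t)", OF J_step[OF that(1)] that(2)] .
  define T where "T k = {t \<in> {0..1}. \<alpha> \<le> J (v k t)}" for k
  have "\<Inter>(range T) \<noteq> {}"
  proof (rule compact_nest)
    show "compact (T k)" for k
    proof -
      have "closed (T k)"
        unfolding T_def by (intro continuous_on_closed_Collect_le J_cont continuous_intros)
      moreover have "T k = {0..1} \<inter> T k" by (auto simp: T_def)
      ultimately show ?thesis
        by (metis compact_Icc compact_Int_closed)
    qed
    show "T n \<subseteq> T k" if "k \<le> n" for k n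
      using J_mono[OF _ that] by (force simp: T_def)
    show "T k \<noteq> {}" for k
    proof -
      have "v k 0 = \<gamma> 0"
        by (induction k) (simp_all add: v_def start)
      then have lo: "Q (v k 0) \<le> \<rho>" using start by simp
      have "J (v k 1) < 0"
        using J_mono[of 1 0 k] finish by (simp add: v_def)
      then have "\<rho> \<le> Q (v k 1)"
        using inside[OF v_into[of 1 k]] by fastforce
      then obtain t where "0 \<le> t" "t \<le> 1" "Q (v k t) = \<rho>"
        using IVT'[of "\<lambda>t. Q (v k t)", OF lo _ _ Q_cont] by auto
      then have "t \<in> T k"
        using rim[OF v_into] by (simp add: T_def)
      then show ?thesis by blast
    qed
  qed
  then obtain t where t: "\<And>k. t \<in> T k" by blast
  show ?thesis
  proof (rule that)
    show "t \<in> {0..1}" using t[of 0] by (simp add: T_def)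
    show "\<alpha> \<le> J ((\<Phi> ^^ k) (\<gamma> t))" for k using t[of k] by (simp add: T_def v_def)
  qed
qed

section \<open>The energy functional\<close>

text \<open>The bounds on \<open>f\<close> and \<open>F\<close> concern nonnegative arguments,
  because the descent stays among nonnegative functions.\<close>

locale superlinear_problem = schroedinger_graph E w \<mu> h m
  for E :: "'v rel" and w :: "'v \<Rightarrow> 'v \<Rightarrow> real" and \<mu> h :: "'v \<Rightarrow> real" and m :: real +
  fixes f F :: "'v \<Rightarrow> real \<Rightarrow> real" and \<theta> :: real
  assumes F_0: "F x 0 = 0"
    and F_deriv: "(F x has_real_derivative f x s) (at s)"
    and f_0: "f x 0 = 0"
    and f_lipschitz: "\<exists>L>0. \<forall>x. \<forall>a\<in>{0..M}. \<forall>b\<in>{0..M}. \<bar>f x a - f x b\<bar> \<le> L * \<bar>a - b\<bar>"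
    and \<theta>_gt_2: "2 < \<theta>"
    and ambrosetti_rabinowitz: "0 < s \<Longrightarrow> 0 < \<theta> * F x s \<and> \<theta> * F x s \<le> s * f x s"
begin

definition J :: "'v set \<Rightarrow> ('v \<Rightarrow> real) \<Rightarrow> real" where
  "J K u = energy K u / 2 - (\<Sum>x\<in>K. \<mu> x * F x (u x))"

text \<open>On \<open>K\<close>, the gradient of \<open>J K\<close> with respect to the Euclidean structure of the coordinates.\<close>

definition grad :: "('v \<Rightarrow> real) \<Rightarrow> 'v \<Rightarrow> real" where
  "grad u x = S u x - \<mu> x * f x (u x)"

definition nonneg_cone :: "'v set \<Rightarrow> ('v \<Rightarrow> real) set" where
  "nonneg_cone K = {u. supported_on K u \<and> (\<forall>x. 0 \<le> u x)}"

lemma cone_supported: "u \<in> nonneg_cone K \<Longrightarrow> supported_on K u"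
  and cone_nonneg: "u \<in> nonneg_cone K \<Longrightarrow> 0 \<le> u x"
  by (simp_all add: nonneg_cone_def)

section \<open>Sign and growth of the nonlinearity\<close>

lemma f_pos: "0 < s \<Longrightarrow> 0 < f x s"
  using ambrosetti_rabinowitz[of s x] zero_less_mult_pos[of s "f x s"] by linarith

lemma f_nonneg: "0 \<le> s \<Longrightarrow> 0 \<le> f x s"
  using f_pos[of s x] f_0[of x] by (cases "s = 0") auto

lemma F_nonneg: "0 \<le> s \<Longrightarrow> 0 \<le> F x s"
proof (cases "s = 0")
  case False
  assume "0 \<le> s"
  with False have "0 < \<theta> * F x s" using ambrosetti_rabinowitz by simp
  then show ?thesis using \<theta>_gt_2 by (simp add: zero_less_mult_iff)
qed (simp add: F_0)

lemma \<theta>_F_le: "0 \<le> s \<Longrightarrow> \<theta> * F x s \<le> s * f x s"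
  using ambrosetti_rabinowitz[of s x] by (cases "s = 0") (simp_all add: F_0)

lemma f_le:
  assumes "\<forall>x. \<forall>a\<in>{0..M}. \<forall>b\<in>{0..M}. \<bar>f x a - f x b\<bar> \<le> L * \<bar>a - b\<bar>" and "0 \<le> s" "s \<le> M"
  shows "f x s \<le> L * s"
proof -
  have "\<bar>f x s - f x 0\<bar> \<le> L * \<bar>s - 0\<bar>"
    using assms by (metis atLeastAtMost_iff order_refl order_trans)
  then show ?thesis using f_0 assms(2) by simp
qed

text \<open>No integration is involved: twice \<open>F\<close> is at most \<theta> times
  \<open>F\<close>, hence at most \<open>s * f x s\<close>, to which the Lipschitz bound
  applies.\<close>

lemma F_le:
  assumes "\<forall>x. \<forall>a\<in>{0..M}. \<forall>b\<in>{0..M}. \<bar>f x a - f x b\<bar> \<le> L * \<bar>a - b\<bar>" and "0 \<le> s" "s \<le> M"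
  shows "2 * F x s \<le> L * s\<^sup>2"
proof -
  have "2 * F x s \<le> \<theta> * F x s"
    using \<theta>_gt_2 F_nonneg[OF assms(2)] by (intro mult_right_mono) auto
  also have "\<dots> \<le> s * (L * s)"
    using \<theta>_F_le[OF assms(2), of x] mult_left_mono[OF f_le[OF assms, of x] assms(2)] by linarith
  finally show ?thesis by (simp add: power2_eq_square mult_ac)
qed

text \<open>The mean value theorem writes the increment as \<open>f x c * (b - a)\<close> with
  \<open>c\<close> between \<open>a\<close> and \<open>b\<close>; replacing \<open>f x c\<close> by
  \<open>f x a\<close> costs the quadratic error.\<close>

lemma F_increment_ge:
  assumes "\<forall>x. \<forall>a\<in>{0..M}. \<forall>b\<in>{0..M}. \<bar>f x a - f x b\<bar> \<le> L * \<bar>a - b\<bar>" and "0 \<le> L"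
    and ab: "a \<in> {0..M}" "b \<in> {0..M}"
  shows "f x a * (b - a) - L * (b - a)\<^sup>2 \<le> F x b - F x a"
proof -
  have "\<exists>c. c \<in> closed_segment a b \<and> F x b - F x a = f x c * (b - a)"
  proof (cases a b rule: linorder_cases)
    case less
    then obtain c where "a < c" "c < b" "F x b - F x a = (b - a) * f x c"
      using MVT2[of a b "F x" "f x"] F_deriv by blast
    then show ?thesis by (intro exI[of _ c]) (auto simp: closed_segment_eq_real_ivl)
  next
    case greater
    then obtain c where "b < c" "c < a" "F x a - F x b = (a - b) * f x c"
      using MVT2[of b a "F x" "f x"] F_deriv by blast
    then show ?thesis
      by (intro exI[of _ c]) (auto simp: closed_segment_eq_real_ivl algebra_simps)
  qed auto
  then obtain c where c: "c \<in> closed_segment a b" "F x b - F x a = f x c * (b - a)"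
    by blast
  have "c \<in> {0..M}" and ca: "\<bar>c - a\<bar> \<le> \<bar>b - a\<bar>"
    using c(1) ab by (auto simp: closed_segment_eq_real_ivl split: if_splits)
  then have "\<bar>f x c - f x a\<bar> \<le> L * \<bar>c - a\<bar>"
    using assms(1) ab by blast
  also have "\<dots> \<le> L * \<bar>b - a\<bar>"
    using ca assms(2) by (rule mult_left_mono)
  finally have "\<bar>(f x c - f x a) * (b - a)\<bar> \<le> L * \<bar>b - a\<bar> * \<bar>b - a\<bar>"
    unfolding abs_mult by (intro mult_right_mono) auto
  moreover have "L * \<bar>b - a\<bar> * \<bar>b - a\<bar> = L * (b - a)\<^sup>2"
    by (simp add: power2_eq_square mult.assoc)
  ultimately have "- (L * (b - a)\<^sup>2) \<le> (f x c - f x a) * (b - a)"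
    by linarith
  then show ?thesis
    unfolding c(2) by (simp add: left_diff_distrib)
qed

section \<open>Continuity in the topology of pointwise convergence\<close>

lemma continuous_on_f: "continuous_on {0..} (f x)"
  unfolding continuous_on_iff
proof (intro ballI allI impI)
  fix s e :: real assume s: "s \<in> {0..}" and e: "0 < e"
  obtain L where L: "0 < L" "\<forall>x. \<forall>a\<in>{0..s + 1}. \<forall>b\<in>{0..s + 1}. \<bar>f x a - f x b\<bar> \<le> L * \<bar>a - b\<bar>"
    using f_lipschitz by blast
  show "\<exists>d>0. \<forall>t\<in>{0..}. dist t s < d \<longrightarrow> dist (f x t) (f x s) < e"
  proof (intro exI[of _ "min 1 (e / L)"] conjI ballI impI)
    fix t :: real assume t: "t \<in> {0..}" "dist t s < min 1 (e / L)"
    then have "\<bar>f x t - f x s\<bar> \<le> L * \<bar>t - s\<bar>"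
      using s L(2) by (auto simp: dist_real_def)
    also have "\<dots> < e"
      using t(2) L(1) by (simp add: dist_real_def field_simps)
    finally show "dist (f x t) (f x s) < e" by (simp add: dist_real_def)
  qed (use e L in auto)
qed

lemma continuous_on_coordinate: "continuous_on C (\<lambda>u::'v \<Rightarrow> real. u x)"
  using continuous_on_product_coordinates by (rule continuous_on_subset) simp

lemma continuous_on_S: "continuous_on C (\<lambda>u. S u x)"
  unfolding S_def by (intro continuous_intros continuous_on_coordinate)

lemma continuous_on_energy: "continuous_on C (energy K)"
  unfolding energy_def by (intro continuous_intros continuous_on_coordinate continuous_on_S)

lemma continuous_on_grad: "continuous_on (nonneg_cone K) (\<lambda>u. grad u x)"
  unfolding grad_def
  by (intro continuous_intros continuous_on_S
      continuous_on_compose2[OF continuous_on_f continuous_on_coordinate]) (auto simp: nonneg_cone_def)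

lemma continuous_on_J: "continuous_on (nonneg_cone K) (J K)"
proof -
  have "continuous_on UNIV (F x)" for x
    using F_deriv by (meson DERIV_isCont continuous_at_imp_continuous_on)
  then show ?thesis
    unfolding J_def
    by (intro continuous_intros continuous_on_energy
        continuous_on_compose2[OF _ continuous_on_coordinate]) auto
qed

text \<open>Subtracting the pairing of \<open>u\<close> with the gradient from \<theta> times
  \<open>J\<close> leaves nonlinear terms whose sign is given by the Ambrosetti-Rabinowitz
  condition. As the factor on the left is positive, control of \<open>J\<close> and of the gradient
  bounds the energy.\<close>

lemma energy_le_J:
  assumes "u \<in> nonneg_cone K"
  shows "(\<theta> / 2 - 1) * energy K u \<le> \<theta> * J K u - (\<Sum>x\<in>K. u x * grad u x)"
proof -
  have "(\<Sum>x\<in>K. \<mu> x * (\<theta> * F x (u x))) \<le> (\<Sum>x\<in>K. \<mu> x * (u x * f x (u x)))"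
    using assms measure_pos
    by (intro sum_mono mult_left_mono \<theta>_F_le) (auto simp: nonneg_cone_def intro: less_imp_le)
  moreover have "(\<Sum>x\<in>K. \<mu> x * (\<theta> * F x (u x))) = \<theta> * (\<Sum>x\<in>K. \<mu> x * F x (u x))"
    by (simp add: sum_distrib_left mult_ac)
  moreover have "(\<Sum>x\<in>K. u x * grad u x) = energy K u - (\<Sum>x\<in>K. \<mu> x * (u x * f x (u x)))"
    by (simp add: grad_def energy_def right_diff_distrib sum_subtractf mult_ac)
  ultimately show ?thesis
    by (simp add: J_def left_diff_distrib right_diff_distrib)
qed

text \<open>The quadratic form expands exactly and \<open>F_increment_ge\<close> handles the rest.
  The estimate shows that a short step against the gradient decreases \<open>J\<close>.\<close>

lemma J_increment_le:
  assumes K: "finite K" and u: "u \<in> nonneg_cone K" and ud: "(\<lambda>x. u x + d x) \<in> nonneg_cone K"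
    and M: "\<And>x. u x \<le> M" "\<And>x. u x + d x \<le> M"
    and L: "\<forall>x. \<forall>a\<in>{0..M}. \<forall>b\<in>{0..M}. \<bar>f x a - f x b\<bar> \<le> L * \<bar>a - b\<bar>" "0 \<le> L"
  shows "J K (\<lambda>x. u x + d x) \<le> J K u + (\<Sum>x\<in>K. d x * grad u x)
           + (\<Lambda> K / 2 + L * (\<Sum>x\<in>K. \<mu> x)) * (L2_set d K)\<^sup>2"
proof -
  have d: "supported_on K d"
    using cone_supported[OF u] cone_supported[OF ud] by (auto simp: supported_on_def)
  have "(\<Sum>x\<in>K. \<mu> x * F x (u x)) + (\<Sum>x\<in>K. d x * (\<mu> x * f x (u x)))
      - L * (\<Sum>x\<in>K. \<mu> x) * (L2_set d K)\<^sup>2 \<le> (\<Sum>x\<in>K. \<mu> x * F x (u x + d x))"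
  proof -
    have "\<mu> x * F x (u x) + d x * (\<mu> x * f x (u x)) - L * \<mu> x * (L2_set d K)\<^sup>2
        \<le> \<mu> x * F x (u x + d x)" for x
    proof -
      have "f x (u x) * d x - L * (d x)\<^sup>2 \<le> F x (u x + d x) - F x (u x)"
        using F_increment_ge[OF L, of "u x" "u x + d x" x] M u ud by (auto simp: nonneg_cone_def)
      moreover have "L * (d x)\<^sup>2 \<le> L * (L2_set d K)\<^sup>2"
        using abs_le_L2_set[OF K d, of x] L(2) by (intro mult_left_mono) (auto simp: abs_le_square_iff[symmetric])
      ultimately have "F x (u x) + d x * f x (u x) - L * (L2_set d K)\<^sup>2 \<le> F x (u x + d x)"
        by (simp add: mult.commute)
      then have "\<mu> x * (F x (u x) + d x * f x (u x) - L * (L2_set d K)\<^sup>2) \<le> \<mu> x * F x (u x + d x)"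
        using measure_pos[of x] by simp
      then show ?thesis by (simp add: algebra_simps)
    qed
    then show ?thesis
      unfolding sum_distrib_left sum_distrib_right sum.distrib[symmetric] sum_subtractf[symmetric]
      by (intro sum_mono)
  qed
  moreover have "energy K d / 2 \<le> \<Lambda> K / 2 * (L2_set d K)\<^sup>2"
    using energy_le[OF K d] by simp
  moreover have "(\<Sum>x\<in>K. d x * grad u x) = (\<Sum>x\<in>K. d x * S u x) - (\<Sum>x\<in>K. d x * (\<mu> x * f x (u x)))"
    by (simp add: grad_def right_diff_distrib sum_subtractf)
  ultimately show ?thesis
    unfolding J_def energy_add[OF K cone_supported[OF u] d] distrib_right
    by (simp only: add_divide_distrib)
qed

lemma L2_grad_le:
  assumes K: "finite K" and u: "u \<in> nonneg_cone K" and M: "\<And>x. u x \<le> M"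
    and L: "\<forall>x. \<forall>a\<in>{0..M}. \<forall>b\<in>{0..M}. \<bar>f x a - f x b\<bar> \<le> L * \<bar>a - b\<bar>" "0 \<le> L"
  shows "L2_set (grad u) K \<le> (\<Lambda> K + L * (\<Sum>x\<in>K. \<mu> x)) * M"
proof -
  have "\<bar>grad u x\<bar> \<le> (2 * wdeg x + \<mu> x * h x) * M + \<mu> x * (L * M)" for x
  proof -
    have "\<bar>S u x\<bar> \<le> (2 * wdeg x + \<mu> x * h x) * M"
      using cone_nonneg[OF u] M by (intro abs_S_le) (simp add: abs_le_iff add_nonneg_nonneg order_trans[of "- _" 0])
    moreover have "f x (u x) \<le> L * M"
      using f_le[OF L(1), of "u x" x] cone_nonneg[OF u, of x] M[of x] mult_left_mono[OF M[of x] L(2)] by linarith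
    then have "\<mu> x * f x (u x) \<le> \<mu> x * (L * M)"
      using measure_pos[of x] by simp
    moreover have "0 \<le> \<mu> x * f x (u x)"
      using measure_pos[of x] f_nonneg[OF cone_nonneg[OF u]] by (simp add: less_imp_le)
    ultimately show ?thesis by (simp add: grad_def)
  qed
  then have "(\<Sum>x\<in>K. \<bar>grad u x\<bar>) \<le> (\<Sum>x\<in>K. (2 * wdeg x + \<mu> x * h x) * M + \<mu> x * (L * M))"
    by (rule sum_mono)
  also have "\<dots> = (\<Lambda> K + L * (\<Sum>x\<in>K. \<mu> x)) * M"
    by (simp add: \<Lambda>_def sum.distrib sum_distrib_right sum_distrib_left algebra_simps)
  finally show ?thesis
    using L2_set_le_sum_abs[of "grad u" K] by linarith
qed

text \<open>In a descent step the neighbours and the nonlinearity only push \<open>u x\<close>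
  upwards. The diagonal term pulls down by at most \<open>s * \<Lambda> K * u x\<close>, hence by at
  most \<open>u x\<close>.\<close>

lemma descent_step_in_cone:
  assumes K: "finite K" and u: "u \<in> nonneg_cone K" and s: "0 \<le> s" "s * \<Lambda> K \<le> 1"
  shows "(\<lambda>x. if x \<in> K then u x - s * grad u x else 0) \<in> nonneg_cone K"
proof -
  have "s * grad u x \<le> u x" if x: "x \<in> K" for x
  proof -
    have "0 \<le> (\<Sum>y\<in>K. W x y * u y)"
      using W_nonneg cone_nonneg[OF u] by (intro sum_nonneg) auto
    moreover have "0 \<le> \<mu> x * f x (u x)"
      using measure_pos[of x] f_nonneg[OF cone_nonneg[OF u]] by (simp add: less_imp_le)
    ultimately have "grad u x \<le> (wdeg x + \<mu> x * h x) * u x"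
      unfolding grad_def S_supported_on[OF K cone_supported[OF u]] by linarith
    also have "\<dots> \<le> \<Lambda> K * u x"
      using \<Lambda>_ge[OF K x] cone_nonneg[OF u] by (rule mult_right_mono)
    finally have "s * grad u x \<le> (s * \<Lambda> K) * u x"
      using s(1) by (simp add: mult_left_mono mult.assoc)
    also have "\<dots> \<le> 1 * u x"
      using s(2) cone_nonneg[OF u] by (rule mult_right_mono)
    finally show ?thesis by simp
  qed
  then show ?thesis by (auto simp: nonneg_cone_def supported_on_def)
qed

lemma J_le_energy:
  assumes "u \<in> nonneg_cone K"
  shows "J K u \<le> energy K u / 2"
proof -
  have "0 \<le> (\<Sum>x\<in>K. \<mu> x * F x (u x))"
    using measure_pos F_nonneg[OF cone_nonneg[OF assms]]
    by (intro sum_nonneg mult_nonneg_nonneg) (auto intro: less_imp_le)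
  then show ?thesis by (simp add: J_def)
qed

text \<open>\<open>orbit_stays_above\<close> supplies an orbit on which \<open>J\<close> never falls
  below \<alpha>. Gradients bounded away from zero would lower \<open>J\<close> by a fixed amount at
  every step of this orbit.\<close>

lemma approximate_critical_point:
  assumes K: "finite K" and e: "e \<in> nonneg_cone K" "J K e < 0" "energy K e / 2 \<le> \<beta>"
    and \<rho>: "0 < \<rho>" and \<alpha>: "0 < \<alpha>"
    and inside: "\<And>u. u \<in> nonneg_cone K \<Longrightarrow> energy K u \<le> \<rho> \<Longrightarrow> 0 \<le> J K u"
    and rim: "\<And>u. u \<in> nonneg_cone K \<Longrightarrow> energy K u = \<rho> \<Longrightarrow> \<alpha> \<le> J K u"
    and \<epsilon>: "0 < \<epsilon>"
  obtains u where "u \<in> nonneg_cone K" and "\<alpha> \<le> J K u" and "J K u \<le> \<beta>" and "L2_set (grad u) K \<le> \<epsilon>"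
proof -
  \<comment> \<open>\<open>c\<close> is half of the coercivity constant; the other half absorbs
    \<open>\<theta> * \<beta>\<close>. For a norm \<open>r > R\<close> the product
    \<open>c * r\<close> exceeds \<open>1 + \<theta> * \<beta>\<close>, which forces the gradient
    norm to be at least 1.\<close>
  define c where "c = (\<theta> / 2 - 1) * m / 2"
  define R where "R = 1 + (1 + \<theta> * \<beta>) / c"
  \<comment> \<open>The bound for the orbit: radius \<open>R\<close>, one step of length at most 1,
    the norm of the endpoint \<open>e\<close>, and twice the possible decrease of
    \<open>J\<close>.\<close>
  define A where "A = R + 1 + L2_set e K + 2 * \<beta>"
  have c: "0 < c" using \<theta>_gt_2 m_pos by (simp add: c_def)
  have "0 \<le> energy K e"
    using energy_ge_L2_set[OF K cone_supported[OF e(1)]] m_pos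
    by (meson less_imp_le mult_nonneg_nonneg order_trans zero_le_power2)
  then have \<beta>: "0 \<le> \<beta>" using e(3) by linarith
  have R: "1 \<le> R" using c \<beta> \<theta>_gt_2 by (simp add: R_def)
  have A: "R + 1 \<le> A" using \<beta> by (simp add: A_def)
  \<comment> \<open>Points that move have norm below \<open>A + 1\<close> and move by at most
    1.\<close>
  obtain L where L: "0 < L" "\<forall>x. \<forall>a\<in>{0..A + 2}. \<forall>b\<in>{0..A + 2}. \<bar>f x a - f x b\<bar> \<le> L * \<bar>a - b\<bar>"
    using f_lipschitz by blast
  define B where "B = \<Lambda> K / 2 + L * (\<Sum>x\<in>K. \<mu> x)"
  define G where "G = (\<Lambda> K + L * (\<Sum>x\<in>K. \<mu> x)) * (A + 2)"
  \<comment> \<open>The three summands of the denominator provide positivity, a second-order error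
    of at most half the first-order decrease, and steps of length at most 1. Since
    \<open>\<Lambda> K \<le> 2 * B\<close>, the cone is preserved as well.\<close>
  define \<eta> where "\<eta> = 1 / (1 + 2 * B + G)"
  \<comment> \<open>Points beyond radius \<open>A + 1\<close> are not moved, which makes a constant step size possible although \<open>grad\<close>
    is only locally Lipschitz. The orbit found below never leaves radius \<open>A\<close>, where \<open>cut\<close> is \<open>1\<close>.\<close>
  define cut where "cut u = max 0 (min 1 (A + 1 - L2_set u K))" for u
  define \<Phi> where "\<Phi> u = (\<lambda>x. if x \<in> K then u x - \<eta> * cut u * grad u x else 0)" for u
  have sum_\<mu>: "0 \<le> L * (\<Sum>x\<in>K. \<mu> x)"
    using L(1) measure_pos by (intro mult_nonneg_nonneg sum_nonneg) (auto intro: less_imp_le)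
  have B: "0 \<le> B" "\<Lambda> K \<le> 2 * B" using sum_\<mu> \<Lambda>_nonneg[of K] by (auto simp: B_def)
  have G: "0 \<le> G" using sum_\<mu> \<Lambda>_nonneg[of K] A R by (simp add: G_def)
  have \<eta>: "0 < \<eta>" "\<eta> * \<Lambda> K \<le> 1" "\<eta> * G \<le> 1" "\<eta> * B \<le> 1 / 2"
    using B G \<Lambda>_nonneg[of K] by (auto simp: \<eta>_def field_simps)
  have cut: "0 \<le> cut u" "cut u \<le> 1" for u
    by (auto simp: cut_def)
  have \<Phi>_into: "\<Phi> u \<in> nonneg_cone K" if "u \<in> nonneg_cone K" for u
  proof -
    have "\<eta> * cut u * \<Lambda> K \<le> \<eta> * 1 * \<Lambda> K"
      using \<eta>(1) cut[of u] \<Lambda>_nonneg[of K] by (intro mult_right_mono mult_left_mono) auto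
    also have "\<dots> \<le> 1" using \<eta>(2) by simp
    finally show ?thesis
      unfolding \<Phi>_def using \<eta>(1) cut[of u] by (intro descent_step_in_cone[OF K that]) auto
  qed
  have \<Phi>_step: "L2_set (\<Phi> u) K \<le> L2_set u K + \<eta> * cut u * L2_set (grad u) K"
      "\<eta> * cut u * L2_set (grad u) K \<le> 1"
      "J K (\<Phi> u) \<le> J K u - \<eta> * cut u * (L2_set (grad u) K)\<^sup>2 / 2"
    if u: "u \<in> nonneg_cone K" for u
  proof -
    define d where "d = (\<lambda>x. if x \<in> K then - (\<eta> * cut u) * grad u x else 0)"
    have \<Phi>_eq: "\<Phi> u = (\<lambda>x. u x + d x)"
      using cone_supported[OF u] by (auto simp: \<Phi>_def d_def supported_on_def)
    have "L2_set d K = L2_set (\<lambda>x. (\<eta> * cut u) * grad u x) K"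
      unfolding L2_set_def d_def by (intro arg_cong[where f = sqrt] sum.cong) (auto simp: power_mult_distrib)
    then have d: "L2_set d K = \<eta> * cut u * L2_set (grad u) K"
      using \<eta>(1) cut[of u] by (simp add: L2_set_right_distrib)
    show norm: "L2_set (\<Phi> u) K \<le> L2_set u K + \<eta> * cut u * L2_set (grad u) K"
      unfolding \<Phi>_eq d[symmetric] by (rule L2_set_triangle_ineq)
    show "\<eta> * cut u * L2_set (grad u) K \<le> 1"
      and "J K (\<Phi> u) \<le> J K u - \<eta> * cut u * (L2_set (grad u) K)\<^sup>2 / 2"
    proof (atomize(full), cases "cut u = 0")
      case True
      then have "\<Phi> u = u"
        using cone_supported[OF u] by (auto simp: \<Phi>_def supported_on_def)
      with True show "\<eta> * cut u * L2_set (grad u) K \<le> 1 \<and>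
          J K (\<Phi> u) \<le> J K u - \<eta> * cut u * (L2_set (grad u) K)\<^sup>2 / 2" by simp
    next
      case False
      then have less: "L2_set u K < A + 1" by (auto simp: cut_def)
      have u_le: "u x \<le> A + 2" for x
        using abs_le_L2_set[OF K cone_supported[OF u], of x] less by linarith
      have "L2_set (grad u) K \<le> G"
        unfolding G_def using L by (intro L2_grad_le[OF K u u_le]) auto
      then have "\<eta> * cut u * L2_set (grad u) K \<le> \<eta> * 1 * G"
        using \<eta>(1) cut[of u] G by (intro mult_mono) auto
      then have le1: "\<eta> * cut u * L2_set (grad u) K \<le> 1"
        using \<eta>(3) by simp
      have \<Phi>u_le: "u x + d x \<le> A + 2" for x
        using abs_le_L2_set[OF K cone_supported[OF \<Phi>_into[OF u]], of x] norm less le1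
        unfolding \<Phi>_eq by linarith
      have "(\<Sum>x\<in>K. d x * grad u x) = - (\<eta> * cut u) * (L2_set (grad u) K)\<^sup>2"
        by (simp add: d_def L2_set_def sum_nonneg sum_distrib_left power2_eq_square mult_ac)
      then have "J K (\<Phi> u) \<le> J K u - \<eta> * cut u * (L2_set (grad u) K)\<^sup>2 + B * (L2_set d K)\<^sup>2"
        using J_increment_le[OF K u _ u_le \<Phi>u_le L(2)] L(1) \<Phi>_into[OF u]
        by (simp add: \<Phi>_eq B_def)
      also have "B * (L2_set d K)\<^sup>2 = (\<eta> * B) * cut u * (\<eta> * cut u * (L2_set (grad u) K)\<^sup>2)"
        unfolding d by (simp add: power2_eq_square mult_ac)
      also have "\<dots> \<le> 1 / 2 * 1 * (\<eta> * cut u * (L2_set (grad u) K)\<^sup>2)"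
        using \<eta> cut[of u] B by (intro mult_right_mono mult_mono) auto
      finally show "\<eta> * cut u * L2_set (grad u) K \<le> 1 \<and>
          J K (\<Phi> u) \<le> J K u - \<eta> * cut u * (L2_set (grad u) K)\<^sup>2 / 2"
        using le1 by simp
    qed
  qed
  have J_\<Phi>: "J K (\<Phi> u) \<le> J K u" if "u \<in> nonneg_cone K" for u
  proof -
    have "0 \<le> \<eta> * cut u * (L2_set (grad u) K)\<^sup>2"
      using \<eta>(1) cut[of u] by simp
    then show ?thesis using \<Phi>_step(3)[OF that] by linarith
  qed
  define \<gamma> where "\<gamma> t = (\<lambda>x. t * e x)" for t
  have \<gamma>_into: "\<gamma> t \<in> nonneg_cone K" if "t \<in> {0..1}" for t
    using that e(1) by (auto simp: \<gamma>_def nonneg_cone_def supported_on_def)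
  have cont_\<Phi>: "continuous_on (nonneg_cone K) \<Phi>"
  proof (rule continuous_on_coordinatewise_then_product)
    show "continuous_on (nonneg_cone K) (\<lambda>u. \<Phi> u x)" for x
      by (cases "x \<in> K") (auto simp: \<Phi>_def cut_def L2_set_def
          intro!: continuous_intros continuous_on_coordinate continuous_on_grad)
  qed
  have cont_\<gamma>: "continuous_on {0..1} \<gamma>"
    unfolding \<gamma>_def by (intro continuous_on_coordinatewise_then_product continuous_intros)
  have "\<gamma> 0 = (\<lambda>x. 0)" by (simp add: \<gamma>_def)
  then have start: "\<Phi> (\<gamma> 0) = \<gamma> 0" "energy K (\<gamma> 0) < \<rho>"
    using \<rho> by (auto simp: \<Phi>_def grad_def S_def f_0 energy_def)
  have finish: "J K (\<gamma> 1) < 0" using e(2) by (simp add: \<gamma>_def)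
  obtain t where t: "t \<in> {0..1}" and above: "\<And>k. \<alpha> \<le> J K ((\<Phi> ^^ k) (\<gamma> t))"
    using orbit_stays_above[where C = "nonneg_cone K" and J = "J K" and Q = "energy K" and \<alpha> = \<alpha>,
        OF cont_\<Phi> continuous_on_J continuous_on_energy cont_\<gamma> \<Phi>_into \<gamma>_into
        J_\<Phi> start finish inside rim] by blast
  define v where "v k = (\<Phi> ^^ k) (\<gamma> t)" for k
  have v_0: "v 0 = \<gamma> t" and v_Suc: "v (Suc k) = \<Phi> (v k)" for k
    by (simp_all add: v_def)
  have v: "v k \<in> nonneg_cone K" for k
    by (induction k) (auto simp: v_0 v_Suc \<gamma>_into[OF t] \<Phi>_into)
  have v_pos: "\<alpha> \<le> J K (v k)" for k using above by (simp add: v_def)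
  have J_\<beta>: "J K (v k) \<le> \<beta>" for k
  proof (induction k)
    case 0
    have "J K (v 0) \<le> t\<^sup>2 * (energy K e / 2)"
      using J_le_energy[OF v[of 0]] by (simp add: v_0 \<gamma>_def energy_scale)
    also have "\<dots> \<le> 1 * (energy K e / 2)"
      using t \<open>0 \<le> energy K e\<close> by (intro mult_right_mono) (auto simp: power_le_one)
    finally show ?case using e(3) by simp
  next
    case (Suc k)
    then show ?case using J_\<Phi>[OF v[of k]] by (simp add: v_Suc)
  qed
  have grad_large: "1 \<le> L2_set (grad (v k)) K" if large: "R < L2_set (v k) K" for k
  proof -
    let ?r = "L2_set (v k) K" and ?g = "L2_set (grad (v k)) K"
    have r: "1 < ?r" using large R by linarith
    have "0 \<le> \<theta> * \<beta>" using \<beta> \<theta>_gt_2 by simp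
    moreover have "c + (1 + \<theta> * \<beta>) < c * ?r"
      using large c by (simp add: R_def field_simps)
    ultimately have rc: "\<theta> * \<beta> \<le> c * ?r" "1 \<le> c * ?r"
      using c by linarith+
    have "\<theta> * \<beta> \<le> c * ?r\<^sup>2"
    proof -
      have "c * ?r * 1 \<le> c * ?r * ?r" using r c by (intro mult_left_mono) auto
      then show ?thesis using rc(1) by (simp add: power2_eq_square)
    qed
    moreover have "2 * c * ?r\<^sup>2 = (\<theta> / 2 - 1) * (m * ?r\<^sup>2)"
      by (simp add: c_def)
    moreover have "(\<theta> / 2 - 1) * (m * ?r\<^sup>2) \<le> (\<theta> / 2 - 1) * energy K (v k)"
      using \<theta>_gt_2 by (intro mult_left_mono energy_ge_L2_set[OF K cone_supported[OF v]]) auto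
    moreover have "\<theta> * J K (v k) \<le> \<theta> * \<beta>"
      using J_\<beta> \<theta>_gt_2 by simp
    moreover have "\<bar>\<Sum>x\<in>K. v k x * grad (v k) x\<bar> \<le> ?r * ?g"
      using L2_set_mult_ineq[of "v k" "grad (v k)" K] sum_abs[of "\<lambda>x. v k x * grad (v k) x" K]
      by (simp add: abs_mult)
    ultimately have "c * ?r\<^sup>2 \<le> ?r * ?g"
      using energy_le_J[OF v[of k]] by linarith
    then have "?r * (c * ?r) \<le> ?r * ?g"
      by (simp add: power2_eq_square mult_ac)
    then show ?thesis using r rc(2) by simp
  qed
  \<comment> \<open>Outside radius \<open>R\<close> the gradient has norm at least \<open>1\<close>, so a step is no longer than twice the
    decrease of \<open>J\<close>, and the total decrease is at most \<open>\<beta>\<close>.\<close>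
  have bound: "L2_set (v k) K \<le> R + 1 + L2_set e K + 2 * (\<beta> - J K (v k))" for k
  proof (induction k)
    case 0
    have "L2_set (v 0) K = t * L2_set e K"
      using t by (simp add: v_0 \<gamma>_def L2_set_right_distrib)
    also have "\<dots> \<le> L2_set e K"
      using t by (intro mult_left_le_one_le) auto
    finally have "L2_set (v 0) K \<le> L2_set e K" .
    then show ?case using R J_\<beta>[of 0] by simp
  next
    case (Suc k)
    let ?s = "\<eta> * cut (v k)" and ?g = "L2_set (grad (v k)) K"
    note step = \<Phi>_step[OF v[of k], folded v_Suc]
    show ?case
    \<comment> \<open>From inside radius \<open>R\<close> one step reaches at most radius
      \<open>R + 1\<close>.\<close>
    proof (cases "L2_set (v k) K \<le> R")
      case True
      then show ?thesis
        using step(1,2) J_\<beta>[of "Suc k"] L2_set_nonneg[of e K]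
        by (smt (verit))
    next
      case False
      then have "?g * 1 \<le> ?g * ?g"
        using grad_large[of k] by (intro mult_left_mono) auto
      then have "?s * ?g \<le> ?s * ?g\<^sup>2"
        using \<eta>(1) cut[of "v k"] by (intro mult_left_mono) (auto simp: power2_eq_square)
      moreover have "?s * ?g\<^sup>2 = 2 * (?s * ?g\<^sup>2 / 2)" by simp
      ultimately show ?thesis using step(1,3) Suc by (smt (verit))
    qed
  qed
  have cut_v: "cut (v k) = 1" for k
    using bound[of k] v_pos[of k] \<alpha> by (simp add: cut_def A_def)
  have "\<exists>k. L2_set (grad (v k)) K \<le> \<epsilon>"
  proof (rule ccontr)
    assume "\<nexists>k. L2_set (grad (v k)) K \<le> \<epsilon>"
    then have big: "\<epsilon> < L2_set (grad (v k)) K" for k by (simp add: not_le)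
    have J_v: "J K (v k) \<le> \<beta> - real k * (\<eta> * \<epsilon>\<^sup>2 / 2)" for k
    proof (induction k)
      case 0
      then show ?case using J_\<beta>[of 0] by simp
    next
      case (Suc k)
      have "\<epsilon>\<^sup>2 \<le> (L2_set (grad (v k)) K)\<^sup>2"
        using big[of k] \<epsilon> by (intro power_mono) auto
      then have "\<eta> * \<epsilon>\<^sup>2 / 2 \<le> \<eta> * (L2_set (grad (v k)) K)\<^sup>2 / 2"
        using \<eta>(1) by simp
      moreover have "J K (v (Suc k)) \<le> J K (v k) - \<eta> * (L2_set (grad (v k)) K)\<^sup>2 / 2"
        using \<Phi>_step(3)[OF v[of k], folded v_Suc] cut_v[of k] by simp
      moreover have "real (Suc k) * (\<eta> * \<epsilon>\<^sup>2 / 2) = \<eta> * \<epsilon>\<^sup>2 / 2 + real k * (\<eta> * \<epsilon>\<^sup>2 / 2)"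
        by (simp add: algebra_simps add_divide_distrib)
      ultimately show ?case using Suc by linarith
    qed
    have "0 < \<eta> * \<epsilon>\<^sup>2 / 2" using \<eta>(1) \<epsilon> by simp
    then obtain k where "\<beta> < real k * (\<eta> * \<epsilon>\<^sup>2 / 2)"
      using reals_Archimedean3 by blast
    then show False using J_v[of k] v_pos[of k] \<alpha> by linarith
  qed
  then show ?thesis using that v v_pos J_\<beta> by blast
qed

text \<open>
  Only the pointwise bounds \<open>a x < l\<close> are available, and they may approach \<open>l\<close> at infinity. The gap
  is recovered from \<open>a x \<le> \<nu> + \<kappa> h x\<close>, where \<open>\<nu>\<close> is the maximum of \<open>a\<close> over the finite set \<open>h < 2 l\<close>,
  so that \<open>\<kappa>\<close> depends on this set only. The choice \<open>\<kappa> = (l - \<nu>) / (2 l)\<close> makes the right-hand side at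
  least \<open>l\<close> elsewhere and leaves the factor \<open>\<nu> / l + \<kappa> = 1 - \<kappa> < 1\<close> after integration against \<open>u\<^sup>2\<close>. The
  extra \<open>\<kappa> / 2\<close> in the proof absorbs the vertices where only the Lipschitz bound on \<open>F\<close> is used.
\<close>

lemma mountain_pass_geometry:
  fixes l :: real
  assumes sublevel: "\<And>M. finite {x. h x < M}"
    and l_pos: "0 < l"
    and eigenvalue: "\<And>K u. finite K \<Longrightarrow> supported_on K u \<Longrightarrow> l * (\<Sum>x\<in>K. \<mu> x * (u x)\<^sup>2) \<le> energy K u"
    and subcritical: "\<And>x. \<exists>a<l. eventually (\<lambda>s. 2 * F x s / s\<^sup>2 < a) (at_right 0)"
  obtains \<kappa> \<delta> where "0 < \<kappa>" and "0 < \<delta>"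
    and "\<And>K u. finite K \<Longrightarrow> u \<in> nonneg_cone K \<Longrightarrow> (\<And>x. u x \<le> \<delta>) \<Longrightarrow> \<kappa> * energy K u \<le> J K u"
proof -
  obtain a where a: "\<And>x. a x < l" "\<And>x. eventually (\<lambda>s. 2 * F x s / s\<^sup>2 < a x) (at_right 0)"
    using subcritical by metis
  define \<nu> where "\<nu> = Max (insert 0 (a ` {x. h x < 2 * l}))"
  have fin: "finite (insert 0 (a ` {x. h x < 2 * l}))"
    using sublevel by simp
  have \<nu>: "0 \<le> \<nu>" "\<nu> < l" "\<And>x. h x < 2 * l \<Longrightarrow> a x \<le> \<nu>"
    unfolding \<nu>_def using fin a(1) l_pos by (auto simp: Max_less_iff intro: Max_ge)
  define \<kappa> where "\<kappa> = (l - \<nu>) / (2 * l)"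
  have \<kappa>: "0 < \<kappa>" "\<kappa> * (2 * l) = l - \<nu>" "\<nu> / l = 1 - 2 * \<kappa>"
    using \<nu>(2) l_pos by (simp_all add: \<kappa>_def field_simps)
  obtain L where L: "0 < L" "\<forall>x. \<forall>a\<in>{0..1}. \<forall>b\<in>{0..1}. \<bar>f x a - f x b\<bar> \<le> L * \<bar>a - b\<bar>"
    using f_lipschitz by blast
  \<comment> \<open>Off \<open>V\<close> the Lipschitz constant is at most
    \<open>\<kappa> / 2 * h x\<close>. As \<open>V\<close> is finite, the pointwise bounds on it
    share one threshold \<open>b\<close>.\<close>
  define V where "V = {x. h x < 2 * L / \<kappa>}"
  have "eventually (\<lambda>s. \<forall>x\<in>V. 2 * F x s / s\<^sup>2 < a x) (at_right 0)"
    using a(2) sublevel by (intro eventually_ball_finite) (auto simp: V_def)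
  then obtain b where b: "0 < b" "\<And>s x. 0 < s \<Longrightarrow> s < b \<Longrightarrow> x \<in> V \<Longrightarrow> 2 * F x s / s\<^sup>2 < a x"
    unfolding eventually_at_right_field by blast
  define \<delta> where "\<delta> = min 1 (b / 2)"
  have F_bound: "2 * F x s \<le> (\<nu> + 3 * \<kappa> / 2 * h x) * s\<^sup>2" if s: "0 \<le> s" "s \<le> \<delta>" for x s
  proof (cases "s = 0")
    case False
    with s have s_pos: "0 < s" by simp
    have h_\<kappa>: "0 < \<kappa> * h x" using \<kappa>(1) h_pos by simp
    show ?thesis
    proof (cases "x \<in> V")
      case True
      have "a x \<le> \<nu> + 3 * \<kappa> / 2 * h x"
      proof (cases "h x < 2 * l")
        case True
        then show ?thesis using \<nu>(3)[OF True] h_\<kappa> by simp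
      next
        case False
        then have "\<kappa> * (2 * l) \<le> \<kappa> * h x"
          using \<kappa>(1) by (intro mult_left_mono) auto
        then show ?thesis using \<kappa>(2) a(1)[of x] h_\<kappa> by linarith
      qed
      moreover have "2 * F x s / s\<^sup>2 < a x"
        using b(2)[OF s_pos _ True] s(2) b(1) by (simp add: \<delta>_def)
      ultimately have "2 * F x s / s\<^sup>2 \<le> \<nu> + 3 * \<kappa> / 2 * h x" by linarith
      then show ?thesis using s_pos by (simp add: pos_divide_le_eq)
    next
      case False
      then have "L \<le> \<kappa> / 2 * h x"
        using \<kappa>(1) by (simp add: V_def field_simps)
      then have "L \<le> \<nu> + 3 * \<kappa> / 2 * h x"
        using \<nu>(1) h_\<kappa> by linarith
      then have "L * s\<^sup>2 \<le> (\<nu> + 3 * \<kappa> / 2 * h x) * s\<^sup>2"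
        by (rule mult_right_mono) simp
      then show ?thesis
        using F_le[OF L(2) s(1), of x] s(2) by (simp add: \<delta>_def)
    qed
  qed (simp add: F_0)
  show ?thesis
  proof (rule that)
    \<comment> \<open>The gain of \<open>\<kappa> / 2\<close> is halved because \<open>J\<close>
      contains half of the energy.\<close>
    show "0 < \<kappa> / 4" "0 < \<delta>" using \<kappa>(1) b(1) by (auto simp: \<delta>_def)
    fix K u assume K: "finite K" and u: "u \<in> nonneg_cone K" and le: "\<And>x. u x \<le> \<delta>"
    have "2 * (\<Sum>x\<in>K. \<mu> x * F x (u x)) \<le> (\<Sum>x\<in>K. \<mu> x * ((\<nu> + 3 * \<kappa> / 2 * h x) * (u x)\<^sup>2))"
      unfolding sum_distrib_left
    proof (rule sum_mono)
      fix x
      have "\<mu> x * (2 * F x (u x)) \<le> \<mu> x * ((\<nu> + 3 * \<kappa> / 2 * h x) * (u x)\<^sup>2)"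
        using F_bound[OF cone_nonneg[OF u] le] measure_pos[of x] by (intro mult_left_mono) auto
      then show "2 * (\<mu> x * F x (u x)) \<le> \<mu> x * ((\<nu> + 3 * \<kappa> / 2 * h x) * (u x)\<^sup>2)"
        by (simp add: mult_ac)
    qed
    also have "\<dots> = \<nu> / l * (l * (\<Sum>x\<in>K. \<mu> x * (u x)\<^sup>2)) + 3 * \<kappa> / 2 * (\<Sum>x\<in>K. \<mu> x * h x * (u x)\<^sup>2)"
    proof -
      have "\<mu> x * ((\<nu> + 3 * \<kappa> / 2 * h x) * (u x)\<^sup>2)
          = \<nu> * (\<mu> x * (u x)\<^sup>2) + 3 * \<kappa> / 2 * (\<mu> x * h x * (u x)\<^sup>2)" for x
        by (simp add: algebra_simps)
      then show ?thesis
        using l_pos by (simp only: sum.distrib sum_distrib_left[symmetric]) simp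
    qed
    also have "\<dots> \<le> \<nu> / l * energy K u + 3 * \<kappa> / 2 * energy K u"
      using eigenvalue[OF K cone_supported[OF u]] energy_ge_potential[OF K cone_supported[OF u]]
        \<nu>(1) l_pos \<kappa>(1) by (intro add_mono mult_left_mono) auto
    also have "\<dots> = energy K u - \<kappa> / 2 * energy K u"
      unfolding \<kappa>(3) by (simp add: algebra_simps)
    finally show "\<kappa> / 4 * energy K u \<le> J K u"
      by (simp add: J_def)
  qed
qed

text \<open>The Ambrosetti-Rabinowitz condition says exactly that
  \<open>F x t * t powr (- \<theta>)\<close> has nonnegative derivative for positive
  \<open>t\<close>.\<close>

lemma F_superquadratic:
  assumes "1 \<le> s"
  shows "F x 1 * s powr \<theta> \<le> F x s"
proof -
  have "F x 1 * 1 powr (- \<theta>) \<le> F x s * s powr (- \<theta>)"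
  proof (rule DERIV_nonneg_imp_nondecreasing[OF assms])
    fix t :: real assume t: "1 \<le> t" "t \<le> s"
    have "((\<lambda>t. F x t * t powr (- \<theta>)) has_real_derivative
        f x t * t powr (- \<theta>) + F x t * (- \<theta> * t powr (- \<theta> - 1))) (at t)"
      using t by (auto intro!: derivative_eq_intros F_deriv)
    moreover have "f x t * t powr (- \<theta>) + F x t * (- \<theta> * t powr (- \<theta> - 1))
        = t powr (- \<theta> - 1) * (t * f x t - \<theta> * F x t)"
      using t by (simp add: powr_diff field_simps)
    moreover have "0 \<le> t powr (- \<theta> - 1) * (t * f x t - \<theta> * F x t)"
      using \<theta>_F_le[of t x] t by simp
    ultimately show "\<exists>y. ((\<lambda>t. F x t * t powr (- \<theta>)) has_real_derivative y) (at t) \<and> 0 \<le> y"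
      by metis
  qed
  then show ?thesis
    using assms by (simp add: powr_minus field_simps)
qed

text \<open>Along the ray through the indicator of one vertex the energy is quadratic, while
  \<open>F\<close> grows at least like the power \<theta> > 2.\<close>

lemma exists_negative_J:
  obtains e where "e \<in> nonneg_cone {z}" and "J {z} e < 0"
proof -
  define d where "d = (\<lambda>x. if x = z then 1 else 0 :: real)"
  define D where "D = energy {z} d"
  have d: "supported_on {z} d" by (simp add: supported_on_def d_def)
  have D: "0 \<le> D"
    using energy_ge_square[OF _ d, of z] m_pos unfolding D_def by (simp add: d_def)
  define P where "P = \<mu> z * F z 1"
  have F1: "0 < P"
    using ambrosetti_rabinowitz[of 1 z] \<theta>_gt_2 measure_pos[of z] by (simp add: P_def zero_less_mult_iff)
  define C where "C = D / (2 * P)"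
  have C: "0 \<le> C" using D F1 by (simp add: C_def)
  \<comment> \<open>\<open>T\<close> solves \<open>T powr (\<theta> - 2) = 1 + C\<close>. Here
    \<open>C\<close> is the ratio at which both terms balance, and the summand 1 makes the
    inequality strict and \<open>T\<close> at least 1.\<close>
  define T where "T = (1 + C) powr (1 / (\<theta> - 2))"
  have T: "1 \<le> T" unfolding T_def using C \<theta>_gt_2 by (intro ge_one_powr_ge_zero) auto
  have "D / 2 < P * (1 + C)"
    using F1 by (simp add: C_def field_simps)
  also have "1 + C = T powr (\<theta> - 2)"
    unfolding T_def using \<theta>_gt_2 C by (simp add: powr_powr)
  finally have "D / 2 * T\<^sup>2 < P * T powr (\<theta> - 2) * T\<^sup>2"
    using T by (intro mult_strict_right_mono) auto
  also have "\<dots> = \<mu> z * (F z 1 * T powr \<theta>)"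
    using T by (simp add: powr_diff P_def)
  also have "\<dots> \<le> \<mu> z * F z T"
    using F_superquadratic[OF T, of z] measure_pos[of z] by simp
  finally have "J {z} (\<lambda>x. T * d x) < 0"
    by (simp add: J_def energy_scale D_def[symmetric] mult_ac) (simp add: d_def)
  moreover have "(\<lambda>x. T * d x) \<in> nonneg_cone {z}"
    using T by (simp add: nonneg_cone_def supported_on_def d_def)
  ultimately show ?thesis using that by blast
qed

section \<open>Exhaustion by finite balls and passage to the limit\<close>

lemma energy_superset:
  assumes "finite K" "A \<subseteq> K" "supported_on A u"
  shows "energy K u = energy A u" and "J K u = J A u"
proof -
  show e: "energy K u = energy A u"
    unfolding energy_def using assms
    by (intro sum.mono_neutral_right) (auto simp: supported_on_def)
  have "(\<Sum>x\<in>K. \<mu> x * F x (u x)) = (\<Sum>x\<in>A. \<mu> x * F x (u x))"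
    using assms by (intro sum.mono_neutral_right) (auto simp: supported_on_def F_0)
  with e show "J K u = J A u" by (simp add: J_def)
qed

lemma finite_walks: "finite {x. (x, z) \<in> E ^^ n}"
proof (induction n arbitrary: z)
  case (Suc n)
  have "{x. (x, z) \<in> E ^^ Suc n} \<subseteq> (\<Union>y\<in>{y. (z, y) \<in> E}. {x. (x, y) \<in> E ^^ n})"
    using sym_edges by (auto dest: symD)
  then show ?case by (rule finite_subset) (auto simp: Suc)
qed simp

lemma exists_positive_solution:
  fixes l :: real
  assumes sublevel: "\<And>M. finite {x. h x < M}"
    and connected: "\<And>x. \<exists>n. (x, z) \<in> E ^^ n"
    and l_pos: "0 < l"
    and eigenvalue: "\<And>K u. finite K \<Longrightarrow> supported_on K u \<Longrightarrow> l * (\<Sum>x\<in>K. \<mu> x * (u x)\<^sup>2) \<le> energy K u"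
    and subcritical: "\<And>x. \<exists>a<l. eventually (\<lambda>s. 2 * F x s / s\<^sup>2 < a) (at_right 0)"
  shows "\<exists>u. \<forall>x. u x > 0 \<and> - laplacian E w \<mu> u x + h x * u x = f x (u x)"
proof -
  obtain \<kappa> \<delta> where \<kappa>: "0 < \<kappa>" and \<delta>: "0 < \<delta>"
    and geometry: "\<And>K u. finite K \<Longrightarrow> u \<in> nonneg_cone K \<Longrightarrow> (\<And>x. u x \<le> \<delta>) \<Longrightarrow> \<kappa> * energy K u \<le> J K u"
    using mountain_pass_geometry[OF sublevel l_pos eigenvalue subcritical] by blast
  obtain e where e: "e \<in> nonneg_cone {z}" "J {z} e < 0"
    using exists_negative_J .
  define B where "B n = (\<Union>k\<le>n. {x. (x, z) \<in> E ^^ k})" for n :: nat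
  \<comment> \<open>The endpoint \<open>e\<close> lives on the single vertex \<open>z\<close>, so
    \<beta> serves for all balls.\<close>
  define \<beta> where "\<beta> = energy {z} e / 2"
  \<comment> \<open>By \<open>energy_ge_square\<close>, energy at most \<rho> forces all values to
    be at most \<delta>.\<close>
  define \<rho> where "\<rho> = m * \<delta>\<^sup>2"
  define \<alpha> where "\<alpha> = \<kappa> * \<rho>"
  have fin_B: "finite (B n)" and z_B: "z \<in> B n" for n
    using finite_walks by (auto simp: B_def intro!: bexI[of _ 0])
  have \<rho>: "0 < \<rho>" and \<alpha>: "0 < \<alpha>" using \<kappa> \<delta> m_pos by (auto simp: \<rho>_def \<alpha>_def)
  have inside: "\<kappa> * energy K u \<le> J K u"
    if K: "finite K" and u: "u \<in> nonneg_cone K" and le: "energy K u \<le> \<rho>" for K u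
  proof (rule geometry[OF K u])
    fix x
    have "m * (u x)\<^sup>2 \<le> m * \<delta>\<^sup>2"
      using energy_ge_square[OF K cone_supported[OF u], of x] le by (simp add: \<rho>_def)
    then have "(u x)\<^sup>2 \<le> \<delta>\<^sup>2" using m_pos by simp
    then show "u x \<le> \<delta>" using \<delta> by (rule power2_le_imp_le[OF _ less_imp_le])
  qed
  have energy_nonneg: "0 \<le> energy K u" if "finite K" "u \<in> nonneg_cone K" for K u
    using energy_ge_L2_set[OF that(1) cone_supported[OF that(2)]]
      mult_nonneg_nonneg[OF less_imp_le[OF m_pos] zero_le_power2[of "L2_set u K"]] by linarith
  have "\<exists>u. u \<in> nonneg_cone (B n) \<and> \<alpha> \<le> J (B n) u \<and> J (B n) u \<le> \<beta> \<and>
      L2_set (grad u) (B n) \<le> inverse (real (Suc n))" for n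
  proof -
    have e_supp: "supported_on {z} e" using e(1) by (rule cone_supported)
    have "{z} \<subseteq> B n" using z_B by simp
    note e_eq = energy_superset[OF fin_B this e_supp]
    have e': "e \<in> nonneg_cone (B n)" "J (B n) e < 0" "energy (B n) e / 2 \<le> \<beta>"
      using e z_B[of n] by (auto simp: e_eq \<beta>_def nonneg_cone_def supported_on_def)
    have pos: "0 \<le> J (B n) u" if "u \<in> nonneg_cone (B n)" "energy (B n) u \<le> \<rho>" for u
      using inside[OF fin_B that] mult_nonneg_nonneg[OF less_imp_le[OF \<kappa>] energy_nonneg[OF fin_B that(1)]]
      by linarith
    have rim: "\<alpha> \<le> J (B n) u" if "u \<in> nonneg_cone (B n)" "energy (B n) u = \<rho>" for u
      using inside[OF fin_B that(1)] that(2) by (auto simp: \<alpha>_def)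
    have "0 < inverse (real (Suc n))" by simp
    from approximate_critical_point[OF fin_B e' \<rho> \<alpha> pos rim this]
    show ?thesis by blast
  qed
  then obtain u where u: "\<And>n. u n \<in> nonneg_cone (B n)" and J_ge: "\<And>n. \<alpha> \<le> J (B n) (u n)"
    and J_le: "\<And>n. J (B n) (u n) \<le> \<beta>"
    and grad_le: "\<And>n. L2_set (grad (u n)) (B n) \<le> inverse (real (Suc n))"
    by metis
  note u_supp = cone_supported[OF u]
  define q where "q = \<theta> / 2 - 1"
  have q: "0 < q" using \<theta>_gt_2 by (simp add: q_def)
  \<comment> \<open>Twice \<open>1 / q\<close> times the right-hand side left over when Young's
    inequality absorbs the norm of \<open>u n\<close> into half of \<open>q\<close> times the
    energy.\<close>
  define C where "C = 2 / q * (\<theta> * \<beta> + 1 / (2 * q * m))"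
  define M where "M = sqrt (C / m)"
  have pairing: "\<bar>\<Sum>x\<in>B n. u n x * grad (u n) x\<bar> \<le> L2_set (u n) (B n) * inverse (real (Suc n))" for n
  proof -
    have "\<bar>\<Sum>x\<in>B n. u n x * grad (u n) x\<bar> \<le> L2_set (u n) (B n) * L2_set (grad (u n)) (B n)"
      using L2_set_mult_ineq[of "u n" "grad (u n)" "B n"] sum_abs[of "\<lambda>x. u n x * grad (u n) x" "B n"]
      by (simp add: abs_mult)
    also have "\<dots> \<le> L2_set (u n) (B n) * inverse (real (Suc n))"
      by (intro mult_left_mono grad_le) auto
    finally show ?thesis .
  qed
  have energy_le_C: "energy (B n) (u n) \<le> C" for n
  proof -
    let ?r = "L2_set (u n) (B n)"
    have "?r * inverse (real (Suc n)) \<le> ?r * 1"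
      by (intro mult_left_mono) (auto simp: field_simps)
    moreover have "?r \<le> q * m * ?r\<^sup>2 / 2 + 1 / (2 * q * m)"
    proof -
      have "0 \<le> (q * m * ?r - 1)\<^sup>2 / (2 * q * m)" using q m_pos by simp
      also have "\<dots> = q * m * ?r\<^sup>2 / 2 + 1 / (2 * q * m) - ?r"
        using q m_pos by (simp add: power2_eq_square field_simps)
      finally show ?thesis by simp
    qed
    moreover have "q * m * ?r\<^sup>2 \<le> q * energy (B n) (u n)"
      using energy_ge_L2_set[OF fin_B u_supp, of n] q by (simp add: mult.assoc)
    moreover have "\<theta> * J (B n) (u n) \<le> \<theta> * \<beta>" using J_le \<theta>_gt_2 by simp
    ultimately have "q * energy (B n) (u n) / 2 \<le> \<theta> * \<beta> + 1 / (2 * q * m)"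
      using energy_le_J[OF u[of n]] pairing[of n] unfolding q_def[symmetric] by linarith
    then show ?thesis using q unfolding C_def by (simp add: field_simps)
  qed
  have r_le_M: "L2_set (u n) (B n) \<le> M" for n
    unfolding M_def using energy_ge_L2_set[OF fin_B u_supp, of n] energy_le_C[of n] m_pos
    by (intro real_le_rsqrt) (simp add: field_simps)
  have u_le_M: "u n x \<le> M" for n x
    using abs_le_L2_set[OF fin_B u_supp, of n x] r_le_M[of n] by linarith
  obtain L where L: "0 < L" "\<forall>x. \<forall>a\<in>{0..M}. \<forall>b\<in>{0..M}. \<bar>f x a - f x b\<bar> \<le> L * \<bar>a - b\<bar>"
    using f_lipschitz by blast
  \<comment> \<open>Off \<open>V\<close> the nonlinear term is at most a quarter of the potential
    term.\<close>
  define V where "V = {x. h x < 4 * L}"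
  have fin_V: "finite V" unfolding V_def by (rule sublevel)
  \<comment> \<open>The energy is at least \<open>2 * \<alpha>\<close>. A quarter of it absorbs the
    nonlinearity off \<open>V\<close>, so three quarters must be carried by \<open>V\<close> and the
    small gradient pairing.\<close>
  have mass: "3 / 2 * \<alpha> \<le> M * inverse (real (Suc n)) + L * (\<Sum>x\<in>V. \<mu> x * (u n x)\<^sup>2)" for n
  proof -
    have pt: "\<mu> x * (u n x * f x (u n x)) \<le>
        L * (if x \<in> V then \<mu> x * (u n x)\<^sup>2 else 0) + 1 / 4 * (\<mu> x * h x * (u n x)\<^sup>2)" for x
    proof -
      have "u n x * f x (u n x) \<le> u n x * (L * u n x)"
        using f_le[OF L(2) cone_nonneg[OF u] u_le_M] cone_nonneg[OF u] by (intro mult_left_mono) auto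
      then have "\<mu> x * (u n x * f x (u n x)) \<le> \<mu> x * (L * (u n x)\<^sup>2)"
        using measure_pos[of x] by (simp add: power2_eq_square mult_ac)
      moreover have "\<mu> x * (L * (u n x)\<^sup>2) \<le> 1 / 4 * (\<mu> x * h x * (u n x)\<^sup>2)" if "x \<notin> V"
      proof -
        have "\<mu> x * L * (u n x)\<^sup>2 \<le> \<mu> x * (h x / 4) * (u n x)\<^sup>2"
          using that measure_pos[of x] by (intro mult_right_mono mult_left_mono) (auto simp: V_def)
        then show ?thesis by (simp add: mult_ac)
      qed
      moreover have "0 \<le> 1 / 4 * (\<mu> x * h x * (u n x)\<^sup>2)"
        using potential_pos[of x] by simp
      ultimately show ?thesis by (auto simp: mult_ac)
    qed
    have V_sum: "(\<Sum>x\<in>B n. if x \<in> V then \<mu> x * (u n x)\<^sup>2 else 0) \<le> (\<Sum>x\<in>V. \<mu> x * (u n x)\<^sup>2)"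
    proof -
      have "(\<Sum>x\<in>B n. if x \<in> V then \<mu> x * (u n x)\<^sup>2 else 0) = (\<Sum>x\<in>B n \<inter> V. \<mu> x * (u n x)\<^sup>2)"
        using fin_B by (simp add: sum.inter_restrict)
      also have "\<dots> \<le> (\<Sum>x\<in>V. \<mu> x * (u n x)\<^sup>2)"
        using fin_V less_imp_le[OF measure_pos] by (intro sum_mono2) auto
      finally show ?thesis .
    qed
    have "(\<Sum>x\<in>B n. \<mu> x * (u n x * f x (u n x))) \<le>
        L * (\<Sum>x\<in>B n. if x \<in> V then \<mu> x * (u n x)\<^sup>2 else 0)
          + 1 / 4 * (\<Sum>x\<in>B n. \<mu> x * h x * (u n x)\<^sup>2)"
      unfolding sum_distrib_left sum.distrib[symmetric] by (intro sum_mono pt)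
    also have "\<dots> \<le> L * (\<Sum>x\<in>V. \<mu> x * (u n x)\<^sup>2) + 1 / 4 * energy (B n) (u n)"
      using V_sum L(1) energy_ge_potential[OF fin_B u_supp, of n]
      by (intro add_mono mult_left_mono) auto
    finally have nonlin: "(\<Sum>x\<in>B n. \<mu> x * (u n x * f x (u n x))) \<le>
        L * (\<Sum>x\<in>V. \<mu> x * (u n x)\<^sup>2) + 1 / 4 * energy (B n) (u n)" .
    have "(\<Sum>x\<in>B n. u n x * grad (u n) x) =
        energy (B n) (u n) - (\<Sum>x\<in>B n. \<mu> x * (u n x * f x (u n x)))"
      by (simp add: grad_def energy_def right_diff_distrib sum_subtractf mult_ac)
    moreover have "L2_set (u n) (B n) * inverse (real (Suc n)) \<le> M * inverse (real (Suc n))"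
      using r_le_M by (intro mult_right_mono) auto
    moreover have "2 * \<alpha> \<le> energy (B n) (u n)"
      using J_ge[of n] J_le_energy[OF u[of n]] by linarith
    ultimately show ?thesis using nonlin pairing[of n] by linarith
  qed
  have UN_B: "(\<Union>n. B n) = UNIV" using connected by (auto simp: B_def)
  have "countable (\<Union>n. B n)" using fin_B by (intro countable_UN) (auto intro: countable_finite)
  then have countable: "countable (UNIV :: 'v set)" unfolding UN_B .
  have norm_u: "norm (u n x) \<le> M" for n x
    using u_le_M cone_nonneg[OF u] by simp
  \<comment> \<open>The uniform bound \<open>M\<close> and countability of the vertex set give one
    subsequence converging at every vertex.\<close>
  obtain r where r: "strict_mono (r :: nat \<Rightarrow> nat)" and conv: "\<And>x. \<exists>y. (\<lambda>n. u (r n) x) \<longlonglongrightarrow> y"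
    using function_convergent_subsequence[of UNIV u M, OF countable norm_u] by (metis UNIV_I)
  obtain U where U: "\<And>x. (\<lambda>n. u (r n) x) \<longlonglongrightarrow> U x"
    using conv by metis
  have U_nonneg: "0 \<le> U x" for x
    by (rule LIMSEQ_le_const[OF U]) (use cone_nonneg[OF u] in auto)
  have inverse_0: "(\<lambda>n. inverse (real (Suc (r n)))) \<longlonglongrightarrow> 0"
    using LIMSEQ_subseq_LIMSEQ[OF LIMSEQ_inverse_real_of_nat r] by (simp add: o_def)
  \<comment> \<open>Both sides involve finitely many values of \<open>U\<close>, so pointwise
    convergence suffices; \<open>x\<close> lies in all sufficiently large balls, where the gradient
    tends to 0.\<close>
  have S_U: "S U x = \<mu> x * f x (U x)" for x
  proof -
    have "(\<lambda>n. f x (u (r n) x)) \<longlonglongrightarrow> f x (U x)"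
      using U_nonneg cone_nonneg[OF u]
      by (intro continuous_on_tendsto_compose[OF continuous_on_f U]) auto
    then have lim: "(\<lambda>n. grad (u (r n)) x) \<longlonglongrightarrow> S U x - \<mu> x * f x (U x)"
      unfolding grad_def S_def by (intro tendsto_intros U)
    obtain N where N: "x \<in> B N" using UN_B by blast
    have "eventually (\<lambda>n. norm (grad (u (r n)) x) \<le> inverse (real (Suc (r n)))) sequentially"
      using eventually_ge_at_top[of N]
    proof eventually_elim
      case (elim n)
      have "N \<le> r n" using elim seq_suble[OF r, of n] by linarith
      with N have "x \<in> B (r n)" unfolding B_def by force
      then have "\<bar>grad (u (r n)) x\<bar> \<le> L2_set (grad (u (r n))) (B (r n))"
        using member_le_L2_set[OF fin_B, of x "r n" "\<lambda>x. \<bar>grad (u (r n)) x\<bar>"] by (simp add: L2_set_def)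
      then show ?case using grad_le[of "r n"] by simp
    qed
    then have "(\<lambda>n. grad (u (r n)) x) \<longlonglongrightarrow> 0"
      by (rule Lim_null_comparison) (rule inverse_0)
    from LIMSEQ_unique[OF lim this] show ?thesis by simp
  qed
  \<comment> \<open>The sum in \<open>mass\<close> runs over the finite set \<open>V\<close>, so the
    limit may be taken termwise.\<close>
  have nontrivial: "\<exists>x. U x \<noteq> 0"
  proof (rule ccontr)
    assume "\<nexists>x. U x \<noteq> 0"
    then have U_0: "U = (\<lambda>x. 0)" by auto
    have "(\<lambda>n. M * inverse (real (Suc (r n))) + L * (\<Sum>x\<in>V. \<mu> x * (u (r n) x)\<^sup>2))
        \<longlonglongrightarrow> M * 0 + L * (\<Sum>x\<in>V. \<mu> x * (U x)\<^sup>2)"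
      by (intro tendsto_intros U inverse_0)
    then have "3 / 2 * \<alpha> \<le> M * 0 + L * (\<Sum>x\<in>V. \<mu> x * (U x)\<^sup>2)"
      by (rule LIMSEQ_le_const) (use mass in auto)
    then show False using \<alpha> by (simp add: U_0)
  qed
  \<comment> \<open>Discrete strong maximum principle: at a zero of \<open>U\<close> the equation
    reduces to a vanishing sum of nonnegative terms over the neighbours.\<close>
  have zero_step: "U y = 0" if x: "U x = 0" and xy: "(x, y) \<in> E" for x y
  proof -
    have "(\<Sum>y | (x, y) \<in> E. w x y * U y) = 0"
      using S_U[of x] x by (simp add: S_eq_wdeg f_0)
    moreover have "0 \<le> w x y * U y" if "(x, y) \<in> E" for y
      using weight_pos[OF that] U_nonneg by simp
    ultimately have "w x y * U y = 0"
      using xy by (subst (asm) sum_nonneg_eq_0_iff) auto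
    then show ?thesis using weight_pos[OF xy] by simp
  qed
  have zero_walk: "U x = 0 \<longleftrightarrow> U y = 0" if "(x, y) \<in> E ^^ n" for x y n
    using that
  proof (induction n arbitrary: y)
    case (Suc n)
    then obtain v where "(x, v) \<in> E ^^ n" "(v, y) \<in> E" by auto
    then show ?case using Suc.IH zero_step sym_edges by (metis symD)
  qed simp
  have "U x \<noteq> 0" for x
    using nontrivial connected zero_walk by metis
  then have U_pos: "0 < U x" for x
    using U_nonneg[of x] by (simp add: order_less_le)
  show ?thesis
  proof (intro exI[of _ U] allI conjI U_pos)
    show "- laplacian E w \<mu> U x + h x * U x = f x (U x)" for x
      using S_U[of x] measure_pos[of x] unfolding S_eq_laplacian by simp
  qed
qed

end

section \<open>Primitives and sublevel sets\<close>

lemma continuous_on_locally_lipschitz_uniformly: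
  assumes "locally_lipschitz_uniformly f"
  shows "continuous_on {a..b} (f x)"
proof -
  obtain L where "\<forall>x. \<forall>s\<in>closed_segment a b. \<forall>t\<in>closed_segment a b. \<bar>f x s - f x t\<bar> \<le> L * \<bar>s - t\<bar>"
    and "L > 0"
    using assms unfolding locally_lipschitz_uniformly_def by meson
  then have "L-lipschitz_on (closed_segment a b) (f x)"
    by (intro lipschitz_onI) (auto simp: dist_real_def)
  then have "continuous_on (closed_segment a b) (f x)"
    by (rule lipschitz_on_continuous_on)
  then show ?thesis
    by (rule continuous_on_subset) (auto simp: closed_segment_eq_real_ivl)
qed

lemma primitive_has_derivative:
  assumes "locally_lipschitz_uniformly f"
  shows "(primitive f x has_real_derivative f x s) (at s)"
proof -
  \<comment> \<open>This interval contains 0 and has \<open>s\<close> in its interior, for either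
    sign of \<open>s\<close>, so the derivative within it is the full derivative.\<close>
  let ?I = "{- \<bar>s\<bar> - 1..\<bar>s\<bar> + 1}"
  have "((\<lambda>u. LBINT t=ereal 0..ereal u. f x t) has_vector_derivative f x s) (at s within ?I)"
    by (rule interval_integral_FTC2[OF _ _ continuous_on_locally_lipschitz_uniformly[OF assms]]) auto
  moreover have "at s within ?I = at s"
    by (rule at_within_interior) (auto simp: interior_atLeastAtMost_real)
  ultimately show ?thesis
    by (simp add: primitive_def[abs_def] has_real_derivative_iff_has_vector_derivative)
qed

lemma primitive_0: "primitive f x 0 = 0"
  by (simp add: primitive_def)

text \<open>A vertex without a walk to \<open>z\<close> has distance \<infinity> and would satisfy
  every lower bound, including \<open>h x + 1\<close>.\<close>

lemma tends_to_infinity_connected: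
  assumes "tends_to_infinity E z h"
  shows "\<exists>n. (x, z) \<in> E ^^ n"
proof (rule ccontr)
  assume "\<nexists>n. (x, z) \<in> E ^^ n"
  then have "graph_dist E x z = \<infinity>"
    by (simp add: graph_dist_def top_enat_def)
  moreover obtain R :: nat where "\<forall>y. graph_dist E y z \<ge> enat R \<longrightarrow> h y \<ge> h x + 1"
    using assms unfolding tends_to_infinity_def by blast
  ultimately show False using not_one_le_zero by (metis add_le_same_cancel1 enat_ord_simps(3))
qed

text \<open>Combined with \<open>finite_walks\<close>, this makes the sublevel sets of
  \<open>h\<close> finite.\<close>

lemma sublevel_subset_walks:
  assumes "tends_to_infinity E z h"
  obtains R where "{x. h x < M} \<subseteq> (\<Union>n<R. {x. (x, z) \<in> E ^^ n})"
proof -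
  obtain R :: nat where R: "\<And>x. graph_dist E x z \<ge> enat R \<Longrightarrow> h x \<ge> M"
    using assms unfolding tends_to_infinity_def by blast
  show ?thesis
  proof (rule that[of R], rule subsetI)
    fix x assume "x \<in> {x. h x < M}"
    then have "graph_dist E x z < enat R" using R[of x] by force
    then show "x \<in> (\<Union>n<R. {x. (x, z) \<in> E ^^ n})"
      by (auto simp: graph_dist_def INF_less_iff)
  qed
qed

text \<open>The indicator of any vertex is a test function of finite energy, so the infimum may be
  treated as a real number.\<close>

lemma (in schroedinger_graph) lambda1_less_top: "lambda1 E w \<mu> h < top"
proof -
  fix z :: 'v
  define d where "d = (\<lambda>x. if x = z then 1 else 0 :: real)"
  have "lambda1 E w \<mu> h * ennreal (\<mu> z) \<le> ennreal (energy {z} d)"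
    using lambda1_le_energy[of "{z}" d] by (simp add: supported_on_def d_def)
  also have "\<dots> < top" by simp
  finally show ?thesis
    using measure_pos[of z] by (auto simp: ennreal_mult_less_top)
qed

section \<open>Reduction of the equation to the abstract setting\<close>

theorem theorem2:
  fixes E :: "'v rel"
    and w :: "'v \<Rightarrow> 'v \<Rightarrow> real"
    and \<mu> h :: "'v \<Rightarrow> real"
    and f :: "'v \<Rightarrow> real \<Rightarrow> real"
    and \<mu>_min h\<^sub>0 \<theta> :: real
    and x\<^sub>0 :: 'v
  assumes "sym E" and "locally_finite E"
    and "\<And>x y. (x, y) \<in> E \<Longrightarrow> w x y > 0"
    and "\<And>x y. (x, y) \<in> E \<Longrightarrow> w x y = w y x"
    and "\<mu>_min > 0" and "\<And>x. \<mu> x \<ge> \<mu>_min"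
    and "h\<^sub>0 > 0" and "\<And>x. h x \<ge> h\<^sub>0"
    and "tends_to_infinity E x\<^sub>0 h"
    and "locally_lipschitz_uniformly f"
    and "\<theta> > 2"
    and "\<And>x s. s > 0 \<Longrightarrow> 0 < \<theta> * primitive f x s \<and> \<theta> * primitive f x s \<le> s * f x s"
    and "\<And>x. Limsup (at_right 0) (\<lambda>s. ereal (2 * primitive f x s / s\<^sup>2))
               < enn2ereal (lambda1 E w \<mu> h)"
  shows "\<exists>u :: 'v \<Rightarrow> real. \<forall>x. u x > 0 \<and>
           - laplacian E w \<mu> u x + h x * u x = f x (u x)"
proof -
  have lower: "\<mu>_min * h\<^sub>0 \<le> \<mu> x * h x" for x
    using assms(5-8) by (intro mult_mono) (auto intro: less_imp_le order_trans)
  have measure_pos: "0 < \<mu> x" for x using assms(5) assms(6)[of x] by linarith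
  have lower_pos: "0 < \<mu>_min * h\<^sub>0" using assms(5,7) by simp
  interpret G: schroedinger_graph E w \<mu> h "\<mu>_min * h\<^sub>0"
    by (rule schroedinger_graph.intro) (fact assms measure_pos lower_pos lower)+
  define l where "l = enn2real (lambda1 E w \<mu> h)"
  have l: "lambda1 E w \<mu> h = ennreal l" "0 \<le> l"
    using G.lambda1_less_top by (simp_all add: l_def)
  have F_pos: "0 < primitive f x s" if "0 < s" for x s
    using assms(12)[OF that, of x] assms(11) by (simp add: zero_less_mult_iff)
  \<comment> \<open>A real number strictly between the limsup and \<open>l\<close> turns the limsup
    into an eventual bound.\<close>
  have subcritical: "\<exists>a<l. eventually (\<lambda>s. 2 * primitive f x s / s\<^sup>2 < a) (at_right 0)" for x
  proof -
    have "Limsup (at_right 0) (\<lambda>s. ereal (2 * primitive f x s / s\<^sup>2)) < ereal l"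
      using assms(13)[of x] l by (simp add: enn2ereal_ennreal)
    from ereal_dense2[OF this] obtain a where
      "Limsup (at_right 0) (\<lambda>s. ereal (2 * primitive f x s / s\<^sup>2)) < ereal a" "ereal a < ereal l"
      by blast
    from Limsup_lessD[OF this(1)] this(2) show ?thesis by auto
  qed
  have pos_eventually: "eventually (\<lambda>s::real. 0 < s) (at_right 0)"
    by (rule eventually_at_right_less)
  \<comment> \<open>The quotients are positive because \<open>F\<close> is, so any eventual upper
    bound \<open>a < l\<close> is positive too.\<close>
  have l_pos: "0 < l"
  proof -
    obtain a where a: "a < l" "eventually (\<lambda>s. 2 * primitive f x\<^sub>0 s / s\<^sup>2 < a) (at_right 0)"
      using subcritical by blast
    have "eventually (\<lambda>s::real. 0 < a) (at_right 0)"
      using a(2) pos_eventually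
    proof eventually_elim
      case (elim s)
      have "0 < 2 * primitive f x\<^sub>0 s / s\<^sup>2" using F_pos[OF elim(2)] elim(2) by simp
      with elim(1) show ?case by linarith
    qed
    then have "0 < a" by (simp add: eventually_const trivial_limit_at_right_real)
    then show ?thesis using a(1) by linarith
  qed
  \<comment> \<open>The quotient \<open>primitive f x s / s\<close> tends to \<open>f x 0\<close>.
    It is nonnegative for \<open>s > 0\<close> and eventually at most \<open>a / 2 * s\<close>,
    hence also tends to 0.\<close>
  have f_0: "f x 0 = 0" for x
  proof -
    obtain a where a: "eventually (\<lambda>s. 2 * primitive f x s / s\<^sup>2 < a) (at_right 0)"
      using subcritical by blast
    have "((\<lambda>s. primitive f x s / s) \<longlongrightarrow> f x 0) (at 0)"
      using primitive_has_derivative[OF assms(10), of x 0] by (simp add: DERIV_def primitive_0)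
    then have lim: "((\<lambda>s. primitive f x s / s) \<longlongrightarrow> f x 0) (at_right 0)"
      by (rule filterlim_mono) (auto simp: at_le)
    have "((\<lambda>s. primitive f x s / s) \<longlongrightarrow> 0) (at_right 0)"
    proof (rule tendsto_sandwich[of "\<lambda>_. 0"])
      show "eventually (\<lambda>s. 0 \<le> primitive f x s / s) (at_right 0)"
        using pos_eventually by eventually_elim (simp add: less_imp_le[OF F_pos])
      show "eventually (\<lambda>s. primitive f x s / s \<le> a / 2 * s) (at_right 0)"
        using a pos_eventually
        by eventually_elim (simp add: field_simps power2_eq_square)
      have "((\<lambda>s. a / 2 * s) \<longlongrightarrow> a / 2 * 0) (at_right 0)"
        by (intro tendsto_intros)
      then show "((\<lambda>s. a / 2 * s) \<longlongrightarrow> 0) (at_right 0)" by simp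
    qed simp
    then show ?thesis
      using tendsto_unique[OF _ lim] by simp
  qed
  have lipschitz: "\<exists>L>0. \<forall>x. \<forall>a\<in>{0..M}. \<forall>b\<in>{0..M}. \<bar>f x a - f x b\<bar> \<le> L * \<bar>a - b\<bar>" for M
  proof -
    obtain L where "L > 0" "\<forall>x. \<forall>a\<in>closed_segment 0 M. \<forall>b\<in>closed_segment 0 M. \<bar>f x a - f x b\<bar> \<le> L * \<bar>a - b\<bar>"
      using assms(10) unfolding locally_lipschitz_uniformly_def by blast
    moreover have "{0..M} \<subseteq> closed_segment 0 M"
      by (auto simp: closed_segment_eq_real_ivl)
    ultimately show ?thesis by blast
  qed
  interpret P: superlinear_problem E w \<mu> h "\<mu>_min * h\<^sub>0" f "primitive f" \<theta>
    by unfold_locales (fact primitive_0 primitive_has_derivative[OF assms(10)] f_0 lipschitz assms)+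
  have sublevel: "finite {x. h x < M}" for M
  proof -
    obtain R where "{x. h x < M} \<subseteq> (\<Union>n<R. {x. (x, x\<^sub>0) \<in> E ^^ n})"
      using sublevel_subset_walks[OF assms(9)] .
    then show ?thesis by (rule finite_subset) (simp add: P.finite_walks)
  qed
  have eigenvalue: "l * (\<Sum>x\<in>K. \<mu> x * (u x)\<^sup>2) \<le> G.energy K u"
    if "finite K" "supported_on K u" for K u
  proof -
    have "ennreal (l * (\<Sum>x\<in>K. \<mu> x * (u x)\<^sup>2)) \<le> ennreal (G.energy K u)"
      using G.lambda1_le_energy[OF that] l by (simp add: ennreal_mult')
    moreover have "0 \<le> G.energy K u"
      using G.energy_ge_square[OF that] G.m_pos
      by (meson less_imp_le mult_nonneg_nonneg order_trans zero_le_power2)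
    ultimately show ?thesis by (simp add: ennreal_le_iff)
  qed
  show ?thesis
    using P.exists_positive_solution[OF sublevel tends_to_infinity_connected[OF assms(9)] l_pos
        eigenvalue subcritical] .
qed

end
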